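(* Let $\mathfrak S=\{S_1,\dots,S_n\}$, $n\ge 1$, be a split system on a multiset $\mathcal M$. Then $\mathfrak S$ is compatible if and only if there exists a consistent thin subgraph $G$ of the split-containment graph $\Gamma(\mathfrak S)$.
   Context: A multiset $\mathcal M$ has underlying set $X$; $\mathcal M(x)\ge 1$ is the multiplicity of $x\in X$. Unions, inclusions, differences and cardinalities of submultisets are taken in the multiset sense. A split of $\mathcal M$ is an unordered pair $\{A,B\}$, written $A|B$, of nonempty submultisets of $\mathcal M$ whose multiset union is $\mathcal M$; for a submultiset $A$, $\overline A=\mathcal M-A$. A split system on $\mathcal M$ is a finite multiset of splits of $\mathcal M$. A labeled tree is a pair $(T,\lambda)$ with $T$ a finite tree and $\lambda$ a map from $V(T)$ to the submultisets of $\mathcal M$; it is an $\mathcal M$-tree if (M1) the multiset union of all labels $\lambda(v)$ is $\mathcal M$ and (M2) every vertex of degree $1$ or $2$ has nonempty label. Removing an edge $e$ of $T$ leaves two components $T_1,T_2$; the split induced by $e$ is $A|B$ where $A$ (resp. $B$) is the multiset union of the labels of vertices of $T_1$ (resp. $T_2$). The split system represented by an $\mathcal M$-tree is the multiset of splits induced by all of its edges. A split system is compatible if it is represented by some $\mathcal M$-tree. Split-containment graph: for $\mathfrak S=\{S_1,\dots,S_n\}$ (repetitions allowed), $\Gamma(\mathfrak S)$ is the digraph whose vertex multiset is $\{(A,S_i): A\in S_i,\ 1\le i\le n\}$ (each $S_i=A|\overline A$ gives vertices $(A,S_i)$ and $(\overline A,S_i)$), with an arc from $(A,S_i)$ to $(B,S_j)$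 whenever $i\ne j$ and $A\subsetneq B$. Let $D_1$ be the digraph on four vertices $v,w,p,q$ with arcs $(v,p),(q,w)$. A subgraph $G$ of $\Gamma(\mathfrak S)$ is thin if $V(G)=V(\Gamma(\mathfrak S))$ and for all distinct $i,j$, with $S_i=A|\overline A$ and $S_j=B|\overline B$, the subgraph of $G$ induced on $\{(A,S_i),(\overline A,S_i),(B,S_j),(\overline B,S_j)\}$ is isomorphic to $D_1$. An arc $((A,S_i),(B,S_j))$ of $G$ is critical if the only directed path in $G$ from $(A,S_i)$ to $(B,S_j)$ is that single arc. For a vertex $(A,S_i)$, $\mathcal C_G((A,S_i))$ is the set of vertices $(B,S_j)$ such that $((B,S_j),(A,S_i))$ is a critical arc of $G$. A thin subgraph $G$ is consistent if for every vertex $(A,S_i)$ of $G$, the multiset union $\bigcup_{(B,S_j)\in\mathcal C_G((A,S_i))}B$ is contained in $A$. *)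

theory Defs
  imports "HOL-Library.Multiset" "Graph_Theory.Graph_Theory"
begin

section \<open>Splits and split systems\<close>

text \<open>
  Unions of multisets are additive throughout (\<open>+\<close> and \<open>\<Sum>\<close>), so that
  \<open>A + (M - A) = M\<close> for every submultiset \<open>A\<close> of \<open>M\<close>.
  An unordered pair \<open>A|B\<close> is the two-element multiset \<open>{#A, B#}\<close>, since \<open>A = B\<close> is possible.
\<close>

type_synonym 'a split = "'a multiset multiset"

definition is_split :: "'a multiset \<Rightarrow> 'a split \<Rightarrow> bool" where
  "is_split M S \<longleftrightarrow> (\<exists>A B. S = {#A, B#} \<and> A \<noteq> {#} \<and> B \<noteq> {#} \<and> A + B = M)"

definition split_system :: "'a multiset \<Rightarrow> 'a split multiset \<Rightarrow> bool" where
  "split_system M SS \<longleftrightarrow> (\<forall>S \<in># SS. is_split M S)"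


section \<open>Labeled trees\<close>

text \<open>
  Undirected graphs are symmetric digraphs. The library predicate \<open>tree\<close> is not the undirected
  notion: it forbids directed cycles, hence also the 2-cycles coming from the two orientations of
  an edge. Only cycles of length at least 3 are cycles of the undirected graph.
\<close>

definition undirected_tree :: "'v pair_pre_digraph \<Rightarrow> bool" where
  "undirected_tree T \<longleftrightarrow>
     pair_graph T \<and> connected (with_proj T) \<and>
     \<not> (\<exists>p. pre_digraph.cycle (with_proj T) p \<and> length p \<ge> 3)"

definition edges :: "'v pair_pre_digraph \<Rightarrow> 'v set set" where
  "edges T = {{u, v} | u v. (u, v) \<in> parcs T}"

definition delete_edge :: "'v pair_pre_digraph \<Rightarrow> 'v set \<Rightarrow> 'v pair_pre_digraph" where
  "delete_edge T e = \<lparr>pverts = pverts T, parcs = {(u, v) \<in> parcs T. {u, v} \<noteq> e}\<rparr>"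

text \<open>In a symmetric digraph the strongly connected components are the connected components.\<close>

definition components :: "'v pair_pre_digraph \<Rightarrow> 'v set set" where
  "components T = pre_digraph.sccs_verts (with_proj T)"

text \<open>In a symmetric digraph the degree of a vertex is its out-degree.\<close>

definition M_tree :: "'a multiset \<Rightarrow> 'v pair_pre_digraph \<Rightarrow> ('v \<Rightarrow> 'a multiset) \<Rightarrow> bool" where
  "M_tree M T lab \<longleftrightarrow>
     undirected_tree T \<and>
     (\<forall>v \<in> pverts T. lab v \<subseteq># M) \<and>
     (\<Sum>v \<in> pverts T. lab v) = M \<and>
     (\<forall>v \<in> pverts T. out_degree (with_proj T) v \<in> {1, 2} \<longrightarrow> lab v \<noteq> {#})"

text \<open>
  Deleting an edge \<open>e\<close> of a tree leaves exactly two components, so that \<open>induced_split T lab e\<close> is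
  a two-element multiset, even when both components carry the same multiset of labels.
\<close>

definition induced_split ::
    "'v pair_pre_digraph \<Rightarrow> ('v \<Rightarrow> 'a multiset) \<Rightarrow> 'v set \<Rightarrow> 'a split" where
  "induced_split T lab e =
     image_mset (\<lambda>W. \<Sum>v \<in> W. lab v) (mset_set (components (delete_edge T e)))"

definition represented_system ::
    "'v pair_pre_digraph \<Rightarrow> ('v \<Rightarrow> 'a multiset) \<Rightarrow> 'a split multiset" where
  "represented_system T lab = image_mset (induced_split T lab) (mset_set (edges T))"

text \<open>
  Every finite tree is isomorphic to one on natural numbers, so it is no restriction to take the
  vertices from \<^typ>\<open>nat\<close>.
\<close>

definition compatible_system :: "'a multiset \<Rightarrow> 'a split multiset \<Rightarrow> bool" where
  "compatible_system M SS \<longleftrightarrow>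
     (\<exists>(T :: nat pair_pre_digraph) lab. M_tree M T lab \<and> represented_system T lab = SS)"


section \<open>The split-containment graph\<close>

text \<open>
  The split system is given by an enumeration \<open>Ss\<close>. The vertex \<open>(A, S\<^sub>i)\<close> is the triple
  \<open>(i, A, k)\<close>, where \<open>k\<close> ranges over the copies of \<open>A\<close> in \<open>S\<^sub>i\<close>: two copies if
  \<open>S\<^sub>i = A|A\<close>, otherwise one. Every split thus contributes exactly two vertices.
\<close>

type_synonym 'a scg_vertex = "nat \<times> 'a multiset \<times> nat"

definition split_index :: "'a scg_vertex \<Rightarrow> nat" where
  "split_index x = fst x"

definition part :: "'a scg_vertex \<Rightarrow> 'a multiset" where
  "part x = fst (snd x)"

definition scg_verts :: "'a split list \<Rightarrow> 'a scg_vertex set" where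
  "scg_verts Ss = {(i, A, k). i < length Ss \<and> k < count (Ss ! i) A}"

definition split_containment_graph :: "'a split list \<Rightarrow> 'a scg_vertex pair_pre_digraph" where
  "split_containment_graph Ss =
     \<lparr>pverts = scg_verts Ss,
      parcs = {(x, y). x \<in> scg_verts Ss \<and> y \<in> scg_verts Ss \<and>
                       split_index x \<noteq> split_index y \<and> part x \<subset># part y}\<rparr>"

text \<open>The vertices \<open>v, w, p, q\<close> are \<open>0, 1, 2, 3\<close>.\<close>

definition D1 :: "nat pair_pre_digraph" where
  "D1 = \<lparr>pverts = {0, 1, 2, 3}, parcs = {(0, 2), (3, 1)}\<rparr>"

definition thin :: "'a split list \<Rightarrow> 'a scg_vertex pair_pre_digraph \<Rightarrow> bool" where
  "thin Ss G \<longleftrightarrow>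
     spanning (with_proj G) (with_proj (split_containment_graph Ss)) \<and>
     (\<forall>i < length Ss. \<forall>j < length Ss. i \<noteq> j \<longrightarrow>
        digraph_iso (with_proj G \<restriction> {x \<in> pverts G. split_index x \<in> {i, j}}) (with_proj D1))"

definition critical :: "'v pair_pre_digraph \<Rightarrow> 'v \<times> 'v \<Rightarrow> bool" where
  "critical G e \<longleftrightarrow>
     e \<in> parcs G \<and> (\<forall>p. pre_digraph.apath (with_proj G) (fst e) p (snd e) \<longrightarrow> p = [e])"

definition critical_preds :: "'v pair_pre_digraph \<Rightarrow> 'v \<Rightarrow> 'v set" where
  "critical_preds G x = {y \<in> pverts G. critical G (y, x)}"

definition consistent :: "'a scg_vertex pair_pre_digraph \<Rightarrow> bool" where
  "consistent G \<longleftrightarrow> (\<forall>x \<in> pverts G. (\<Sum>y \<in> critical_preds G x. part y) \<subseteq># part x)"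

end

theory Submission
  imports Defs
begin

text \<open>
  A split system represented by a tree yields a thin subgraph by strict inclusion of the vertex
  sets on the tail sides of the oriented edges. The critical predecessors of an oriented edge have
  disjoint tail sides, all contained in its own, which gives consistency.

  Conversely, in a consistent thin subgraph two ancestors of a vertex are either comparable along
  paths or have parts whose sizes add up to at most that of the vertex. This excludes paths from
  \<open>(A, S\<^sub>i)\<close> to \<open>(M - A, S\<^sub>i)\<close>, so the subgraph is a transitive relation, i.e. a strict order
  reversed by complementation in which any two splits are nested in exactly one way. Its elements
  are the oriented edges of a tree: two of them point to the same vertex iff one is a critical
  predecessor of the complement of the other. The label of a vertex is what the parts of the oriented
  edges pointing to it leave of \<open>M\<close>; by consistency these labels add up to the part of an oriented
  edge over all vertices behind it.
\<close>

section \<open>Sides of the edges of a tree\<close>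

text \<open>For sets, containment of parts alone decides the arcs. In a multiset a part can lie
  strictly inside both \<open>B\<close> and its complement, so between two splits a thin subgraph
  makes a genuine choice, and choices made pair by pair need not be transitive: with one element of
  multiplicity 8, parts \<open>x\<close>, \<open>y\<close>, \<open>z\<close> of sizes 1, 2, 3 admit
  arcs from \<open>x\<close> to \<open>y\<close>, from \<open>y\<close> to \<open>z\<close> and from
  \<open>x\<close> to the complement of \<open>z\<close>, hence a path from \<open>x\<close> to its
  own complement. Only consistency rules this out, and it speaks about critical arcs of a subgraph
  not yet known to be transitive; this is why sizes have to be counted. For the same reason the arcs
  obtained from a given tree are read off vertex sets: containment of labels does not tell how the
  edges are nested. In the converse direction no vertices are given in advance; they have to be made
  from oriented edges, as classes with a common head.\<close>

lemma pair_graph_delete_edge: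
  assumes "pair_graph T"
  shows "pair_graph (delete_edge T e)"
proof -
  interpret pair_graph T by fact
  show ?thesis
  proof
    show "symmetric (with_proj (delete_edge T e))"
      using arcs_symmetric by (auto simp: symmetric_def sym_def delete_edge_def insert_commute)
  qed (use pair_finite_verts in \<open>auto simp: delete_edge_def dest: in_arcsD1 in_arcsD2 pair_no_loops
         intro: finite_subset[OF _ pair_finite_arcs]\<close>)
qed

lemma reachable_iff_rtrancl:
  assumes "pair_graph T"
  shows "u \<rightarrow>\<^sup>*\<^bsub>with_proj T\<^esub> v \<longleftrightarrow> u \<in> pverts T \<and> (u, v) \<in> (parcs T)\<^sup>*"
proof -
  interpret pair_graph T by fact
  show ?thesis
    by (metis reachable_conv' reachable_in_verts(1))
qed

lemma (in pair_graph) mk_symmetric_with_proj: "mk_symmetric (with_proj G) = G"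
proof -
  have "parcs (mk_symmetric (with_proj G)) = parcs G"
    using arcs_symmetric by (auto simp: mk_symmetric_def)
  then show ?thesis
    by (simp add: mk_symmetric_def)
qed

text \<open>Stated for arbitrary \<open>A\<close> and \<open>B\<close> because it is needed twice:
  for the sides of an edge in a given tree, and for the sets \<open>behind x\<close> in the
  constructed graph before that graph is known to be a tree.\<close>

lemma components_delete_edge:
  assumes T: "pair_graph T"
    and cover: "A \<union> B = pverts T" and disj: "A \<inter> B = {}" and uA: "u \<in> A" and vB: "v \<in> B"
    and A: "\<And>a. a \<in> A \<Longrightarrow> (a, u) \<in> (parcs (delete_edge T {u, v}))\<^sup>*"
    and B: "\<And>b. b \<in> B \<Longrightarrow> (b, v) \<in> (parcs (delete_edge T {u, v}))\<^sup>*"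
    and cut: "\<And>a b. a \<in> A \<Longrightarrow> b \<in> B \<Longrightarrow> (a, b) \<notin> parcs (delete_edge T {u, v})"
  shows "components (delete_edge T {u, v}) = {A, B}"
proof -
  let ?D = "delete_edge T {u, v}"
  interpret D: pair_graph ?D by (rule pair_graph_delete_edge[OF T])
  have verts: "pverts ?D = A \<union> B"
    by (simp add: delete_edge_def cover)
  have sym: "(x, y) \<in> (parcs ?D)\<^sup>* \<Longrightarrow> (y, x) \<in> (parcs ?D)\<^sup>*" for x y
    using D.arcs_symmetric by (metis sym_def sym_rtrancl)
  have inA: "y \<in> A" if "(x, y) \<in> (parcs ?D)\<^sup>*" "x \<in> A" for x y
    using that
  proof induction
    case (step y z)
    then show ?case using cut D.in_arcsD2 verts by blast
  qed
  have inB: "y \<in> B" if "(x, y) \<in> (parcs ?D)\<^sup>*" "x \<in> B" for x y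
    using that sym inA disj D.wellformed verts
  proof induction
    case (step y z)
    then show ?case using cut[of z y] D.in_arcsD2 D.arcs_symmetric verts by blast
  qed
  have reach: "x \<rightarrow>\<^sup>*\<^bsub>with_proj ?D\<^esub> y \<longleftrightarrow> x \<in> A \<and> y \<in> A \<or> x \<in> B \<and> y \<in> B" for x y
  proof -
    have "(x, y) \<in> (parcs ?D)\<^sup>*" if "x \<in> A \<and> y \<in> A \<or> x \<in> B \<and> y \<in> B"
      using that A B sym by (meson rtrancl_trans)
    then show ?thesis
      using inA inB by (auto simp: reachable_iff_rtrancl[OF D.pair_graph] verts)
  qed
  show ?thesis
  proof (intro set_eqI iffI)
    fix S assume "S \<in> components ?D"
    then have ne: "S \<noteq> {}"
      and conn: "\<And>x y. x \<in> S \<Longrightarrow> y \<in> S \<Longrightarrow> x \<in> A \<and> y \<in> A \<or> x \<in> B \<and> y \<in> B"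
      and max: "\<And>x y. x \<in> S \<Longrightarrow> x \<in> A \<and> y \<in> A \<or> x \<in> B \<and> y \<in> B \<Longrightarrow> y \<in> S"
      by (auto simp: components_def D.sccs_verts_def reach)
    then show "S \<in> {A, B}"
      using disj by blast
  next
    fix S assume "S \<in> {A, B}"
    then show "S \<in> components ?D"
      using uA vB disj by (auto simp: components_def D.sccs_verts_def reach)
  qed
qed

locale udtree =
  fixes T :: "'v pair_pre_digraph"
  assumes tree: "undirected_tree T"
begin

sublocale pair_graph T
  using tree by (simp add: undirected_tree_def)

definition side :: "'v \<Rightarrow> 'v \<Rightarrow> 'v set" where
  "side u v = {w. (u, w) \<in> (parcs (delete_edge T {u, v}))\<^sup>*}"

lemma start_in_side: "u \<in> side u v"
  by (simp add: side_def)

lemma parcs_delete_edge_iff: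
  "(x, y) \<in> parcs (delete_edge T e) \<longleftrightarrow> (x, y) \<in> parcs T \<and> {x, y} \<noteq> e"
  by (simp add: delete_edge_def)

lemma parcs_delete_edge_sym:
  "(x, y) \<in> (parcs (delete_edge T e))\<^sup>* \<Longrightarrow> (y, x) \<in> (parcs (delete_edge T e))\<^sup>*"
proof -
  have "sym (parcs (delete_edge T e))"
    using arcs_symmetric by (auto simp: sym_def parcs_delete_edge_iff insert_commute)
  then show "(x, y) \<in> (parcs (delete_edge T e))\<^sup>* \<Longrightarrow> (y, x) \<in> (parcs (delete_edge T e))\<^sup>*"
    by (meson sym_rtrancl symD)
qed

lemma side_step:
  assumes "x \<in> side u v" "(x, y) \<in> parcs T" "{x, y} \<noteq> {u, v}"
  shows "y \<in> side u v"
  using assms rtrancl_into_rtrancl[of u x "parcs (delete_edge T {u, v})" y]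
  by (simp add: side_def parcs_delete_edge_iff)

lemma side_subset_verts: "u \<in> pverts T \<Longrightarrow> side u v \<subseteq> pverts T"
proof
  fix w assume u: "u \<in> pverts T" and "w \<in> side u v"
  then have "(u, w) \<in> (parcs (delete_edge T {u, v}))\<^sup>*" by (simp add: side_def)
  then show "w \<in> pverts T"
    by (induction) (auto simp: u parcs_delete_edge_iff dest: in_arcsD2)
qed

text \<open>A path from \<open>u\<close> to \<open>v\<close> avoiding the edge has at least two
  arcs, since the only one-arc path is the deleted edge; with \<open>(v, u)\<close> it closes to a
  cycle of length at least 3. The later facts about sides draw on acyclicity only through this
  lemma.\<close>

lemma end_notin_side:
  assumes "(u, v) \<in> parcs T"
  shows "v \<notin> side u v"
proof
  assume "v \<in> side u v"
  let ?D = "delete_edge T {u, v}"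
  interpret D: pair_graph ?D by (rule pair_graph_delete_edge) (rule pair_graph)
  have "u \<rightarrow>\<^sup>*\<^bsub>with_proj ?D\<^esub> v"
    using \<open>v \<in> side u v\<close> in_arcsD1[OF assms]
    by (simp add: reachable_iff_rtrancl[OF D.pair_graph] side_def) (simp add: delete_edge_def)
  then obtain p where p: "D.apath u p v"
    using D.reachable_apath by blast
  have sub: "set p \<subseteq> parcs ?D" and pT: "apath u p v"
    using p by (auto simp: D.apath_def apath_def D.awalk_def awalk_def parcs_delete_edge_iff)
      (simp_all add: delete_edge_def)
  have "p \<noteq> []"
    using assms pair_no_loops p by (auto simp: D.apath_Nil_iff)
  moreover have "p \<noteq> [a]" for a
    using pT sub by (cases a) (auto simp: apath_Cons_iff apath_Nil_iff delete_edge_def)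
  ultimately have "length p \<ge> 2"
    by (cases p rule: remdups_adj.cases) auto
  moreover have "cycle ((v, u) # p)"
    using pT assms arcs_symmetric by (auto simp: cycle_def apath_def awalk_Cons_iff intro!: exI[of _ v])
  moreover have "\<not> (\<exists>p. cycle p \<and> length p \<ge> 3)"
    using tree by (simp add: undirected_tree_def)
  ultimately show False
    by (metis Suc_le_mono length_Cons numeral_2_eq_2 numeral_3_eq_3)
qed

lemma connected_rtrancl:
  assumes "u \<in> pverts T" "v \<in> pverts T"
  shows "(u, v) \<in> (parcs T)\<^sup>*"
  using tree assms reachable_iff_rtrancl[OF pair_graph]
  by (simp add: undirected_tree_def connected_def strongly_connected_def mk_symmetric_with_proj)

lemma side_Un: "(u, v) \<in> parcs T \<Longrightarrow> side u v \<union> side v u = pverts T"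
proof (intro equalityI subsetI)
  fix w assume e: "(u, v) \<in> parcs T" and w: "w \<in> pverts T"
  then have "(u, w) \<in> (parcs T)\<^sup>*"
    using connected_rtrancl in_arcsD1 by blast
  then show "w \<in> side u v \<union> side v u"
  proof induction
    case (step y z)
    then show ?case
      using side_step[of y u v z] side_step[of y v u z] start_in_side
      by (metis Un_iff doubleton_eq_iff)
  qed (simp add: start_in_side)
qed (use side_subset_verts in \<open>auto dest: in_arcsD1 in_arcsD2\<close>)

lemma side_Int: "(u, v) \<in> parcs T \<Longrightarrow> side u v \<inter> side v u = {}"
proof (rule ccontr)
  assume e: "(u, v) \<in> parcs T" and "side u v \<inter> side v u \<noteq> {}"
  then obtain w where "w \<in> side u v" "w \<in> side v u" by blast
  then have "(u, w) \<in> (parcs (delete_edge T {u, v}))\<^sup>*" "(w, v) \<in> (parcs (delete_edge T {u, v}))\<^sup>*"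
    by (auto simp: side_def insert_commute parcs_delete_edge_sym)
  then have "v \<in> side u v"
    by (simp add: side_def)
  then show False
    using end_notin_side e by blast
qed

lemma side_compl: "(u, v) \<in> parcs T \<Longrightarrow> side v u = pverts T - side u v"
  using side_Un[of u v] side_Int[of u v] by auto

text \<open>A walk inside \<open>side p q\<close> never meets an end of the edge
  \<open>{u, v}\<close>, so deleting that edge does not disturb it and the whole side stays where
  \<open>p\<close> is. Strictness comes from the end \<open>u\<close> or \<open>v\<close> on that
  side.\<close>

lemma side_subset_if_edge_outside:
  assumes e: "(u, v) \<in> parcs T" and f: "(p, q) \<in> parcs T"
    and out: "u \<notin> side p q" "v \<notin> side p q"
  shows "side p q \<subset> side u v \<or> side p q \<subset> side v u"
proof -
  have stay: "side p q \<subseteq> side a b" if "p \<in> side a b" "{a, b} = {u, v}" for a b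
  proof
    fix w assume "w \<in> side p q"
    then have "(p, w) \<in> (parcs (delete_edge T {p, q}))\<^sup>*" by (simp add: side_def)
    then show "w \<in> side a b"
    proof induction
      case (step y z)
      then have "y \<in> side p q" by (simp add: side_def)
      then show ?case
        using step out side_step[of y a b z] that(2)
        by (metis doubleton_eq_iff parcs_delete_edge_iff)
    qed (simp add: that)
  qed
  have "p \<in> side u v \<or> p \<in> side v u"
    using side_Un[OF e] in_arcsD1[OF f] by blast
  then show ?thesis
    using stay[of u v] stay[of v u] out start_in_side by blast
qed

text \<open>An edge other than \<open>{p, q}\<close> cannot cross between the two sides of
  \<open>{p, q}\<close>, so it misses one of them entirely, and that one is nested in a side of
  \<open>{u, v}\<close>.\<close>

lemma nested_sides:
  assumes e: "(u, v) \<in> parcs T" and f: "(p, q) \<in> parcs T" and "{u, v} \<noteq> {p, q}"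
  shows "side p q \<subset> side u v \<or> side p q \<subset> side v u \<or> side q p \<subset> side u v \<or> side q p \<subset> side v u"
proof -
  have "u \<in> side p q \<longleftrightarrow> v \<in> side p q" 
    using side_step[of u p q v] side_step[of v p q u] e arcs_symmetric assms(3) by (metis insert_commute)
  moreover have "u \<in> pverts T" "v \<in> pverts T"
    using e in_arcsD1 in_arcsD2 by auto
  ultimately show ?thesis
    using side_subset_if_edge_outside[OF e f]
      side_subset_if_edge_outside[OF e arcs_symmetric[OF f]] side_compl[OF f] by blast
qed

lemma components_delete_edge_eq_sides:
  assumes e: "(u, v) \<in> parcs T"
  shows "components (delete_edge T {u, v}) = {side u v, side v u}"
proof (rule components_delete_edge)
  show "(a, u) \<in> (parcs (delete_edge T {u, v}))\<^sup>*" if "a \<in> side u v" for a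
    using that parcs_delete_edge_sym by (auto simp: side_def)
  show "(b, v) \<in> (parcs (delete_edge T {u, v}))\<^sup>*" if "b \<in> side v u" for b
    using that parcs_delete_edge_sym by (auto simp: side_def insert_commute)
  show "(a, b) \<notin> parcs (delete_edge T {u, v})" if "a \<in> side u v" "b \<in> side v u" for a b
    using that side_step[of a u v b] side_Int[OF e] by (auto simp: parcs_delete_edge_iff)
qed (simp_all add: side_Un[OF e] side_Int[OF e] start_in_side pair_graph)

lemma induced_split_eq:
  assumes e: "(u, v) \<in> parcs T"
  shows "induced_split T lab {u, v} = {# \<Sum>w\<in>side u v. lab w, \<Sum>w\<in>side v u. lab w #}"
proof -
  have "side u v \<noteq> side v u"
    using side_Int[OF e] start_in_side by blast
  then show ?thesis
    by (simp add: induced_split_def components_delete_edge_eq_sides[OF e])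
qed

lemma side_subset_step:
  assumes e: "(u, v) \<in> parcs T" and f: "(w, u) \<in> parcs T" and "w \<noteq> v"
  shows "side w u \<subset> side u v"
proof -
  have "u \<notin> side w u" using end_notin_side f by blast
  moreover have "v \<notin> side w u"
    using side_step[of v w u u] arcs_symmetric[OF e] \<open>u \<notin> side w u\<close> assms(3)
    by (metis doubleton_eq_iff e in_arcsD1 no_loops')
  moreover have "w \<in> side u v"
    using side_step[OF start_in_side, of u w v] arcs_symmetric[OF f] assms(3)
    by (auto simp: doubleton_eq_iff)
  ultimately show ?thesis
    using side_subset_if_edge_outside[OF e f] side_Int[OF e] start_in_side by blast
qed

text \<open>By \<open>side_subset_step\<close>, what lies behind \<open>(w, u)\<close> lies behind
  \<open>(u, w')\<close>, the complement of \<open>side w' u\<close>.\<close>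

lemma side_disjoint_siblings:
  assumes "(w, u) \<in> parcs T" and "(w', u) \<in> parcs T" and "w \<noteq> w'"
  shows "side w u \<inter> side w' u = {}"
  using side_subset_step[OF arcs_symmetric[OF assms(2)] assms(1,3)] side_Int[OF assms(2)] by auto

end

section \<open>Labels on the sides of an edge\<close>

lemma (in pair_graph) out_degree_eq_card: "out_degree (with_proj G) u = card {w. (u, w) \<in> parcs G}"
proof -
  have "out_arcs (with_proj G) u = Pair u ` {w. (u, w) \<in> parcs G}"
    by (auto simp: out_arcs_def)
  then show ?thesis
    by (simp add: out_degree_def card_image inj_on_def)
qed

lemma (in pair_graph) finite_neighbours: "finite {w. (u, w) \<in> parcs G}"
  by (rule finite_subset[OF _ pair_finite_verts]) (auto dest: in_arcsD2)

locale labelled_tree = udtree T for T :: "'v pair_pre_digraph" +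
  fixes M :: "'a multiset" and lab :: "'v \<Rightarrow> 'a multiset"
  assumes M_tree: "M_tree M T lab"
begin

lemma finite_side: "(u, v) \<in> parcs T \<Longrightarrow> finite (side u v)"
  using side_subset_verts in_arcsD1 pair_finite_verts finite_subset by metis

lemma label_nonempty: "v \<in> pverts T \<Longrightarrow> card {w. (v, w) \<in> parcs T} \<in> {1, 2} \<Longrightarrow> lab v \<noteq> {#}"
  using M_tree by (auto simp: M_tree_def out_degree_eq_card)

text \<open>Moving away from the edge to ever smaller sides ends at a leaf, which (M2) forces to be
  labelled.\<close>

lemma side_label_nonempty:
  "(u, v) \<in> parcs T \<Longrightarrow> \<exists>w \<in> side u v. lab w \<noteq> {#}"
proof (induction "card (side u v)" arbitrary: u v rule: less_induct)
  case less
  show ?case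
  proof (cases "\<exists>w. w \<noteq> v \<and> (w, u) \<in> parcs T")
    case True
    then obtain w where w: "w \<noteq> v" "(w, u) \<in> parcs T" by blast
    have "side w u \<subset> side u v"
      using side_subset_step less.prems w by blast
    moreover from this have "card (side w u) < card (side u v)"
      using finite_side[OF less.prems] by (simp add: psubset_card_mono)
    ultimately show ?thesis
      using less.hyps[of w u] w by blast
  next
    case False
    then have "{w. (u, w) \<in> parcs T} = {v}"
      using less.prems arcs_symmetric by blast
    then have "lab u \<noteq> {#}"
      using label_nonempty in_arcsD1[OF less.prems] by simp
    then show ?thesis
      using start_in_side by blast
  qed
qed

text \<open>With \<open>p\<close> outside \<open>side r s\<close>, the edge \<open>{c, p}\<close>
  either is \<open>{r, s}\<close> itself or has both ends outside, and then it cannot cut the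
  connected set \<open>side r s\<close> in two.\<close>

lemma side_subset_or_disjoint:
  assumes f: "(r, s) \<in> parcs T" and e: "(c, p) \<in> parcs T" and out: "p \<notin> side r s"
  shows "side r s \<subseteq> side c p \<or> side r s \<inter> side c p = {}"
proof (cases "{c, p} = {r, s}")
  case True
  then show ?thesis using out start_in_side[of r s] by (auto simp: doubleton_eq_iff)
next
  case False
  then have "c \<notin> side r s"
    using out side_step[of c r s p] e by blast
  then show ?thesis
    using side_subset_if_edge_outside[OF e f _ out] side_Int[OF e] by blast
qed

text \<open>If the vertex \<open>p\<close> is unlabelled, it has two further neighbours besides \<open>q\<close>, and the side
  of one of them misses \<open>side r s\<close>.\<close>

lemma side_diff_label_nonempty:
  assumes f: "(r, s) \<in> parcs T" and e: "(p, q) \<in> parcs T" and sub: "side r s \<subset> side p q"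
  shows "\<exists>w \<in> side p q - side r s. lab w \<noteq> {#}"
proof -
  \<comment> \<open>Otherwise \<open>(p, q)\<close> would leave \<open>side r s\<close>, hence be
    the edge \<open>{r, s}\<close>, whose two sides are not strictly nested.\<close>
  have "p \<notin> side r s"
  proof
    assume "p \<in> side r s"
    moreover have "q \<notin> side r s"
      using sub end_notin_side[OF e] by blast
    ultimately have "{p, q} = {r, s}"
      using side_step e by blast
    then show False
      using sub side_Int[OF e] start_in_side[of r s] by (auto simp: doubleton_eq_iff)
  qed
  show ?thesis
  proof (cases "lab p = {#}")
    case False
    then show ?thesis using \<open>p \<notin> side r s\<close> start_in_side by blast
  next
    case True
    let ?N = "{w. (p, w) \<in> parcs T}"
    have "card ?N \<noteq> 0" "card ?N \<notin> {1, 2}"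
      using label_nonempty[OF in_arcsD1[OF e]] True e finite_neighbours[of p]
      by (auto simp: card_eq_0_iff)
    then have "card (?N - {q}) \<ge> 2"
      using e by (subst card_Diff_singleton) auto
    then obtain c c' where "{c, c'} \<subseteq> ?N - {q}" "c \<noteq> c'"
      by (metis obtain_subset_with_card_n card_2_iff)
    then have c: "(c, p) \<in> parcs T" "c \<noteq> q" and c': "(c', p) \<in> parcs T" "c' \<noteq> q" and "c \<noteq> c'"
      using arcs_symmetric by auto
    have "side r s \<inter> side c p = {} \<or> side r s \<inter> side c' p = {}"
      using side_subset_or_disjoint[OF f c(1) \<open>p \<notin> side r s\<close>]
        side_subset_or_disjoint[OF f c'(1) \<open>p \<notin> side r s\<close>]
        side_disjoint_siblings[OF c(1) c'(1) \<open>c \<noteq> c'\<close>] by blast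
    then obtain d where d: "(d, p) \<in> parcs T" "d \<noteq> q" "side r s \<inter> side d p = {}"
      using c c' by blast
    then show ?thesis
      using side_label_nonempty[OF d(1)] side_subset_step[OF e d(1,2)] by blast
  qed
qed

abbreviation weight :: "'v set \<Rightarrow> 'a multiset" where
  "weight W \<equiv> \<Sum>w\<in>W. lab w"

text \<open>This is what (M2) is for: arcs of the split-containment graph demand strict containment
  of parts, whereas nested vertex sets alone give only weak containment of label sums.\<close>

lemma weight_side_strict_mono:
  assumes f: "(r, s) \<in> parcs T" and e: "(p, q) \<in> parcs T" and sub: "side r s \<subset> side p q"
  shows "weight (side r s) \<subset># weight (side p q)"
proof -
  have fin: "finite (side p q)" by (rule finite_side[OF e])
  have "weight (side p q) = weight (side p q - side r s) + weight (side r s)"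
    using sub fin by (intro sum.subset_diff) auto
  moreover have "weight (side p q - side r s) \<noteq> {#}"
    using side_diff_label_nonempty[OF assms] fin by (auto simp: sum_eq_empty_iff)
  ultimately show ?thesis
    by (simp add: subset_mset.less_le)
qed

end

section \<open>Critical arcs and thin subgraphs\<close>

text \<open>Criticality is defined through paths without repeated vertices. In an acyclic graph
  every walk is such a path, so a competing path is simply an intermediate vertex of the transitive
  closure.\<close>

lemma critical_iff:
  assumes wf: "pair_wf_digraph G" and acyclic: "acyclic (parcs G)"
  shows "critical G (x, y) \<longleftrightarrow>
    (x, y) \<in> parcs G \<and> \<not> (\<exists>z. (x, z) \<in> (parcs G)\<^sup>+ \<and> (z, y) \<in> (parcs G)\<^sup>+)"
proof -
  interpret pair_wf_digraph G by fact
  have awalk_apath: "apath u p v" if "awalk u p v" for u p v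
    using that
  proof (induction p arbitrary: u)
    case (Cons e es)
    then have e: "e \<in> parcs G" "u = fst e" and es: "awalk (snd e) es v"
      by (auto simp: awalk_Cons_iff)
    have "u \<notin> set (awalk_verts (snd e) es)"
    proof
      assume "u \<in> set (awalk_verts (snd e) es)"
      then have "snd e \<rightarrow>\<^sup>*\<^bsub>with_proj G\<^esub> u"
        using awalk_verts_reachable_from es by blast
      then have "(snd e, u) \<in> (parcs G)\<^sup>*"
        using reachable_conv by blast
      then have "(u, u) \<in> (parcs G)\<^sup>+"
        using e by (metis prod.collapse rtrancl_into_trancl2)
      then show False
        using acyclic by (auto simp: acyclic_def)
    qed
    then show ?case
      using Cons.IH[OF es] e by (auto simp: apath_Cons_iff)
  qed (auto simp: apath_Nil_iff awalk_Nil_iff)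
  show ?thesis
  proof (intro iffI conjI)
    assume crit: "critical G (x, y)"
    then show "(x, y) \<in> parcs G"
      by (simp add: critical_def)
    show "\<not> (\<exists>z. (x, z) \<in> (parcs G)\<^sup>+ \<and> (z, y) \<in> (parcs G)\<^sup>+)"
    proof
      assume "\<exists>z. (x, z) \<in> (parcs G)\<^sup>+ \<and> (z, y) \<in> (parcs G)\<^sup>+"
      then obtain z p q where p: "awalk x p z" "p \<noteq> []" and q: "awalk z q y" "q \<noteq> []"
        using reachable1_awalk by blast
      have "apath x (p @ q) y"
        using awalk_apath awalk_appendI[OF p(1) q(1)] by blast
      then have "p @ q = [(x, y)]"
        using crit by (auto simp: critical_def)
      then show False
        using p(2) q(2) by (auto simp: append_eq_Cons_conv)
    qed
  next
    assume R: "(x, y) \<in> parcs G \<and> \<not> (\<exists>z. (x, z) \<in> (parcs G)\<^sup>+ \<and> (z, y) \<in> (parcs G)\<^sup>+)"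
    have "p = [(x, y)]" if p: "apath x p y" for p
    proof (cases p)
      case Nil
      then have "x = y" using p by (simp add: apath_Nil_iff)
      then show ?thesis using R acyclic by (auto simp: acyclic_def)
    next
      case (Cons e es)
      then have e: "e \<in> parcs G" "fst e = x" and es: "awalk (snd e) es y"
        using p by (auto simp: apath_def awalk_Cons_iff)
      have xe: "(x, snd e) \<in> (parcs G)\<^sup>+"
        using e by (auto intro: r_into_trancl)
      have "es = []"
      proof (rule ccontr)
        assume "es \<noteq> []"
        then have "(snd e, y) \<in> (parcs G)\<^sup>+"
          using es reachable1_awalk by blast
        then show False using R xe by blast
      qed
      then show ?thesis
        using Cons e es by (auto simp: awalk_Nil_iff)
    qed
    then show "critical G (x, y)"
      using R by (simp add: critical_def)
  qed
qed

lemma digraph_iso_D1_iff: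
  "digraph_iso (with_proj G \<restriction> S) (with_proj D1) \<longleftrightarrow>
    (\<exists>a b c d. distinct [a, b, c, d] \<and> S = {a, b, c, d} \<and> parcs G \<inter> S \<times> S = {(a, b), (c, d)})"
    (is "?L \<longleftrightarrow> ?R")
proof
  let ?H = "with_proj G \<restriction> S"
  have A: "arcs ?H = parcs G \<inter> S \<times> S"
    by (auto simp: induce_subgraph_def)
  have th: "tail ?H = fst" "head ?H = snd" "verts ?H = S"
    by (auto simp: induce_subgraph_def)
  {
    assume ?L
    then obtain f where f: "pre_digraph.digraph_isomorphism ?H f" and D1: "with_proj D1 = app_iso f ?H"
      by (auto simp: digraph_iso_def)
    from arg_cong[OF D1, of verts] arg_cong[OF D1, of arcs] arg_cong[OF D1, of tail] arg_cong[OF D1, of head]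
    have v: "iso_verts f ` S = {0, 1, 2, 3}" and a: "iso_arcs f ` (parcs G \<inter> S \<times> S) = {(0, 2), (3, 1)}"
      and t: "iso_tail f = fst" and h: "iso_head f = snd"
      by (auto simp: D1_def A th)
    have inj: "inj_on (iso_verts f) S" and inja: "inj_on (iso_arcs f) (parcs G \<inter> S \<times> S)"
      and hom: "\<And>e. e \<in> parcs G \<inter> S \<times> S \<Longrightarrow> iso_arcs f e = (iso_verts f (fst e), iso_verts f (snd e))"
      using f unfolding pre_digraph.digraph_isomorphism_def A th t h by (auto simp: prod_eq_iff)
    have pre: "\<exists>x\<in>S. iso_verts f x = n" if "n \<in> {0, 1, 2, 3}" for n
      using that[folded v] by auto
    \<comment> \<open>The order 0, 2, 3, 1 follows the arcs \<open>(0, 2)\<close> and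
      \<open>(3, 1)\<close> of \<open>D1\<close>, so that they become \<open>(a, b)\<close> and
      \<open>(c, d)\<close>.\<close>
    obtain a b c d where abcd: "a \<in> S" "b \<in> S" "c \<in> S" "d \<in> S"
      "iso_verts f a = 0" "iso_verts f b = 2" "iso_verts f c = 3" "iso_verts f d = 1"
      using pre[of 0] pre[of 2] pre[of 3] pre[of 1] by auto
    have inv: "x = y" if "iso_verts f x = iso_verts f y" "x \<in> S" "y \<in> S" for x y
      using inj that by (simp add: inj_on_def)
    have "S = {a, b, c, d}"
    proof
      show "S \<subseteq> {a, b, c, d}"
      proof
        fix x assume x: "x \<in> S"
        then have "iso_verts f x \<in> {0, 1, 2, 3}" using v by blast
        then show "x \<in> {a, b, c, d}" using inv[of x] x abcd by auto
      qed
    qed (use abcd in auto)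
    moreover have "distinct [a, b, c, d]" using abcd by auto
    moreover have "parcs G \<inter> S \<times> S = {(a, b), (c, d)}"
    proof (intro equalityI subsetI)
      fix e assume e: "e \<in> parcs G \<inter> S \<times> S"
      then have "iso_arcs f e \<in> {(0, 2), (3, 1)}" using a by blast
      then have "iso_verts f (fst e) = 0 \<and> iso_verts f (snd e) = 2 \<or> iso_verts f (fst e) = 3 \<and> iso_verts f (snd e) = 1"
        using hom[OF e] by auto
      then show "e \<in> {(a, b), (c, d)}"
        using e abcd inv by (cases e) auto
    next
      fix e assume e: "e \<in> {(a, b), (c, d)}"
      then have "(iso_verts f (fst e), iso_verts f (snd e)) \<in> iso_arcs f ` (parcs G \<inter> S \<times> S)"
        unfolding a using abcd by auto
      then obtain e' where e': "e' \<in> parcs G \<inter> S \<times> S"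
        "iso_verts f (fst e) = iso_verts f (fst e')" "iso_verts f (snd e) = iso_verts f (snd e')"
        using hom by auto
      then have "e = e'"
        using inv[of "fst e" "fst e'"] inv[of "snd e" "snd e'"] e abcd by (auto simp: prod_eq_iff)
      then show "e \<in> parcs G \<inter> S \<times> S" using e' by simp
    qed
    ultimately show ?R by blast
  }
  {
    assume ?R
    then obtain a b c d where abcd: "distinct [a, b, c, d]" "S = {a, b, c, d}"
      "parcs G \<inter> S \<times> S = {(a, b), (c, d)}" by blast
    define g where "g = (\<lambda>x. if x = a then 0 else if x = b then 2 else if x = c then 3 else (1::nat))"
    define f where "f = \<lparr>iso_verts = g, iso_arcs = map_prod g g, iso_head = snd, iso_tail = fst\<rparr>"
    have "wf_digraph ?H"
      by (auto simp: wf_digraph_def A th)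
    moreover have g: "g a = 0" "g b = 2" "g c = 3" "g d = 1"
      using abcd(1) by (auto simp: g_def)
    moreover have "inj_on g S"
      unfolding abcd(2) using g by (simp add: inj_on_def)
    moreover have "inj_on (map_prod g g) {(a, b), (c, d)}"
      using g by (simp add: inj_on_def)
    ultimately have "pre_digraph.digraph_isomorphism ?H f"
      unfolding pre_digraph.digraph_isomorphism_def A th abcd(3) by (simp add: f_def)
    moreover have "with_proj D1 = app_iso f ?H"
    proof -
      have "g ` S = {0, 1, 2, 3}" unfolding abcd(2) using g by auto
      then show ?thesis
        unfolding app_iso_def A th abcd(3) by (simp add: with_proj_def D1_def f_def g)
    qed
    ultimately show ?L by (auto simp: digraph_iso_def)
  }
qed

section \<open>The two orientations of a split, and thinness expressed arc by arc\<close>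

lemma add_mset_doubleton_eq_iff:
  "{#a, b#} = {#c, d#} \<longleftrightarrow> a = c \<and> b = d \<or> a = d \<and> b = c"
  by (auto simp: add_eq_conv_ex)

text \<open>Taken by index and not by complementing the part: for a split \<open>A|A\<close> both
  vertices carry the same part and differ only in the copy number.\<close>

definition opposite :: "'a split list \<Rightarrow> 'a scg_vertex \<Rightarrow> 'a scg_vertex" where
  "opposite Ss x = (THE y. y \<in> scg_verts Ss \<and> split_index y = split_index x \<and> y \<noteq> x)"

locale split_list =
  fixes M :: "'a multiset" and Ss :: "'a split list"
  assumes splits: "split_system M (mset Ss)"
begin

abbreviation darts :: "'a scg_vertex set" where "darts \<equiv> scg_verts Ss"
abbreviation opp :: "'a scg_vertex \<Rightarrow> 'a scg_vertex" where "opp \<equiv> opposite Ss"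

lemma index_less: "x \<in> darts \<Longrightarrow> split_index x < length Ss"
  by (auto simp: scg_verts_def split_index_def)

lemma darts_of_split:
  assumes i: "i < length Ss"
  obtains x y where "x \<noteq> y" "{z \<in> darts. split_index z = i} = {x, y}"
    "Ss ! i = {#part x, part y#}" "part x + part y = M" "part x \<noteq> {#}" "part y \<noteq> {#}"
proof -
  obtain A B where AB: "Ss ! i = {#A, B#}" "A \<noteq> {#}" "B \<noteq> {#}" "A + B = M"
  proof -
    have "is_split M (Ss ! i)"
      using splits i by (simp add: split_system_def)
    then show ?thesis
      using that by (auto simp: is_split_def)
  qed
  have eq: "{z \<in> darts. split_index z = i} = {(i', C, k). i' = i \<and> k < count {#A, B#} C}"
    using i AB(1) by (auto simp: scg_verts_def split_index_def)
  show ?thesis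
  proof (cases "A = B")
    case True
    have "{(i', C, k). i' = i \<and> k < count {#A, B#} C} = {(i, A, 0), (i, B, 1)}"
      using True by (auto split: if_splits)
    then show ?thesis
      using that[of "(i, A, 0)" "(i, B, 1)"] eq AB by (auto simp: part_def)
  next
    case False
    then have "{(i', C, k). i' = i \<and> k < count {#A, B#} C} = {(i, A, 0), (i, B, 0)}"
      by (auto split: if_splits)
    then show ?thesis
      using that[of "(i, A, 0)" "(i, B, 0)"] eq AB False by (auto simp: part_def)
  qed
qed

lemma
  assumes x: "x \<in> darts"
  shows opp_in_darts: "opp x \<in> darts"
    and index_opp: "split_index (opp x) = split_index x"
    and opp_neq: "opp x \<noteq> x"
    and opp_opp: "opp (opp x) = x"
    and same_index: "y \<in> darts \<Longrightarrow> split_index y = split_index x \<Longrightarrow> y = x \<or> y = opp x"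
    and split_eq: "Ss ! split_index x = {#part x, part (opp x)#}"
    and part_opp: "part x + part (opp x) = M"
    and part_nonempty: "part x \<noteq> {#}"
proof -
  obtain a b where ab: "a \<noteq> b" "{z \<in> darts. split_index z = split_index x} = {a, b}"
    and S: "Ss ! split_index x = {#part a, part b#}" and M: "part a + part b = M"
    and ne: "part a \<noteq> {#}" "part b \<noteq> {#}"
    by (rule darts_of_split[OF index_less[OF x]])
  have "x \<in> {a, b}" using ab(2) x by blast
  then obtain y where y: "{a, b} = {x, y}" "y \<noteq> x"
    using ab(1) by blast
  have uniq: "z \<in> darts \<and> split_index z = split_index x \<longleftrightarrow> z = x \<or> z = y" for z
    using ab(2) y(1) by auto
  have opp_x: "opp x = y"
    unfolding opposite_def using uniq y(2) by (intro the_equality) auto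
  then show "opp x \<in> darts" "split_index (opp x) = split_index x" "opp x \<noteq> x"
    using uniq[of y] y(2) by auto
  then show "opp (opp x) = x"
    unfolding opposite_def[of _ "opp x"] using uniq y(2) opp_x x by (intro the_equality) auto
  show "y' \<in> darts \<Longrightarrow> split_index y' = split_index x \<Longrightarrow> y' = x \<or> y' = opp x" for y'
    using uniq[of y'] opp_x by simp
  have "(a = x \<and> b = y) \<or> (a = y \<and> b = x)"
    using y(1) by (auto simp: doubleton_eq_iff)
  then show "Ss ! split_index x = {#part x, part (opp x)#}" "part x + part (opp x) = M" "part x \<noteq> {#}"
    using S M ne opp_x by (auto simp: add_mset_commute add.commute)
qed

lemma same_index_iff: "x \<in> darts \<Longrightarrow> y \<in> darts \<Longrightarrow> split_index y = split_index x \<longleftrightarrow> y = x \<or> y = opp x"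
  using same_index index_opp by metis

lemma ex_dart: "i < length Ss \<Longrightarrow> \<exists>x \<in> darts. split_index x = i"
  by (erule darts_of_split) blast

lemma finite_darts: "finite darts"
proof -
  have "finite {z \<in> darts. split_index z = i}" if "i < length Ss" for i
    by (rule darts_of_split[OF that]) simp
  moreover have "darts = (\<Union>i<length Ss. {z \<in> darts. split_index z = i})"
    using index_less by auto
  ultimately show ?thesis
    by (metis (no_types, lifting) finite_UN finite_lessThan lessThan_iff)
qed

lemma part_opp_mono:
  assumes "x \<in> darts" "y \<in> darts" "part x \<subset># part y"
  shows "part (opp y) \<subset># part (opp x)"
proof -
  have "part x + part (opp x) = part y + part (opp y)"
    using part_opp assms by metis
  moreover obtain C where "part y = part x + C" "C \<noteq> {#}"
    using assms(3) by (metis add.right_neutral subset_mset.less_imp_le subset_mset.le_iff_add subset_mset.less_irrefl)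
  ultimately have "part (opp x) = C + part (opp y)"
    by (simp add: add.assoc)
  then show ?thesis
    using \<open>C \<noteq> {#}\<close> by (simp add: subset_mset.less_le)
qed

text \<open>The two arcs of a copy of \<open>D1\<close> on \<open>x, opp x, y, opp y\<close> must be
  mirror images under \<open>opp\<close>: they are vertex-disjoint and join different splits, so the
  second is \<open>(opp b, opp a)\<close> or \<open>(opp a, opp b)\<close>, and complementation
  reverses strict containment. Hence exactly one of four nestings holds per pair of splits, and
  closure under \<open>opp\<close> supplies its twin.\<close>

lemma thin_iff:
  "thin Ss G \<longleftrightarrow> pverts G = darts \<and> parcs G \<subseteq> parcs (split_containment_graph Ss) \<and>
    (\<forall>(x, y) \<in> parcs G. (opp y, opp x) \<in> parcs G \<and> (x, opp y) \<notin> parcs G) \<and>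
    (\<forall>x \<in> darts. \<forall>y \<in> darts. split_index x \<noteq> split_index y \<longrightarrow>
      (x, y) \<in> parcs G \<or> (y, x) \<in> parcs G \<or> (x, opp y) \<in> parcs G \<or> (opp y, x) \<in> parcs G)"
  (is "_ \<longleftrightarrow> ?V \<and> ?E \<and> ?O \<and> ?C")
proof -
  have span: "spanning (with_proj G) (with_proj (split_containment_graph Ss)) \<longleftrightarrow> ?V \<and> ?E"
    by (auto simp: spanning_def subgraph_def compatible_def split_containment_graph_def wf_digraph_def)
  have four: "{x \<in> darts. split_index x \<in> {i, j}} = {x, opp x, y, opp y}"
    if "x \<in> darts" "y \<in> darts" "split_index x = i" "split_index y = j" for i j x y
  proof (rule set_eqI)
    show "z \<in> {x \<in> darts. split_index x \<in> {i, j}} \<longleftrightarrow> z \<in> {x, opp x, y, opp y}" for z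
      using same_index_iff[OF that(1), of z] same_index_iff[OF that(2), of z] that
        opp_in_darts[OF that(1)] opp_in_darts[OF that(2)] by auto
  qed
  let ?iso = "\<lambda>x y. digraph_iso (with_proj G \<restriction> {x, opp x, y, opp y}) (with_proj D1)"
  have "thin Ss G \<longleftrightarrow> ?V \<and> ?E \<and> (\<forall>x \<in> darts. \<forall>y \<in> darts. split_index x \<noteq> split_index y \<longrightarrow> ?iso x y)"
  proof -
    have "(\<forall>i < length Ss. \<forall>j < length Ss. i \<noteq> j \<longrightarrow>
        digraph_iso (with_proj G \<restriction> {x \<in> darts. split_index x \<in> {i, j}}) (with_proj D1)) \<longleftrightarrow>
      (\<forall>x \<in> darts. \<forall>y \<in> darts. split_index x \<noteq> split_index y \<longrightarrow> ?iso x y)"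
      (is "?l \<longleftrightarrow> ?r")
    proof
      assume l: ?l
      show ?r
      proof (intro ballI impI)
        fix x y assume xy: "x \<in> darts" "y \<in> darts" "split_index x \<noteq> split_index y"
        then have "digraph_iso (with_proj G \<restriction> {z \<in> darts. split_index z \<in> {split_index x, split_index y}})
            (with_proj D1)"
          using l index_less by blast
        then show "?iso x y"
          unfolding four[OF xy(1,2) refl refl] .
      qed
    next
      assume r: ?r
      show ?l
      proof (intro allI impI)
        fix i j assume "i < length Ss" "j < length Ss" "i \<noteq> j"
        then obtain x y where "x \<in> darts" "y \<in> darts" "split_index x = i" "split_index y = j"
          using ex_dart by meson
        then show "digraph_iso (with_proj G \<restriction> {x \<in> darts. split_index x \<in> {i, j}}) (with_proj D1)"
          using r four[of x y i j] \<open>i \<noteq> j\<close> by simp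
      qed
    qed
    then show ?thesis
      unfolding thin_def span by auto
  qed
  also have "\<dots> \<longleftrightarrow> ?V \<and> ?E \<and> ?O \<and> ?C"
  proof (cases "?V \<and> ?E")
    case VE: True
    have E: "x \<in> darts \<and> y \<in> darts \<and> split_index x \<noteq> split_index y \<and> part x \<subset># part y"
      if "(x, y) \<in> parcs G" for x y
      using that VE by (auto simp: split_containment_graph_def)
    have iso_imp: "\<exists>a \<in> darts. \<exists>b \<in> darts.
        parcs G \<inter> {x, opp x, y, opp y} \<times> {x, opp x, y, opp y} = {(a, b), (opp b, opp a)}"
      if xy: "x \<in> darts" "y \<in> darts" "split_index x \<noteq> split_index y" and iso: "?iso x y" for x y
    proof -
      let ?S = "{x, opp x, y, opp y}"
      obtain a b c d where abcd: "distinct [a, b, c, d]" "?S = {a, b, c, d}"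
        "parcs G \<inter> ?S \<times> ?S = {(a, b), (c, d)}"
        using iso unfolding digraph_iso_D1_iff by (elim exE conjE)
      have inS: "a \<in> ?S" "b \<in> ?S" "c \<in> ?S" "d \<in> ?S"
        unfolding abcd(2) by auto
      have S: "z \<in> darts \<and> opp z \<in> ?S" if "z \<in> ?S" for z
        using that xy opp_in_darts[OF xy(1)] opp_in_darts[OF xy(2)] opp_opp[OF xy(1)] opp_opp[OF xy(2)] by auto
      have "(a, b) \<in> parcs G" "(c, d) \<in> parcs G" using abcd(3) by blast+
      note ab = E[OF this(1)] and cd = E[OF this(2)]
      \<comment> \<open>If it were, then \<open>d = opp b\<close>, and \<open>part (opp a)\<close>
        and \<open>part (opp b)\<close> would strictly contain each other.\<close>
      have "c \<noteq> opp a"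
      proof
        assume c: "c = opp a"
        have "opp b \<in> {a, b, c, d}" using S[OF inS(2)] abcd(2) by simp
        moreover have "opp b \<noteq> a" using ab index_opp by metis
        moreover have "opp b \<noteq> b" using ab opp_neq by blast
        moreover have "opp b \<noteq> c" using c ab index_opp by metis
        ultimately have "d = opp b" by blast
        then have "part (opp a) \<subset># part (opp b)" using cd c by simp
        moreover have "part (opp b) \<subset># part (opp a)" using part_opp_mono ab by blast
        ultimately show False by (simp add: subset_mset.less_le_not_le)
      qed
      moreover have "opp a \<in> {a, b, c, d}" using S[OF inS(1)] abcd(2) by simp
      moreover have "opp a \<noteq> b" using ab index_opp by metis
      moreover have "opp a \<noteq> a" using ab opp_neq by blast
      ultimately have d: "d = opp a" by blast
      have "opp b \<in> {a, b, c, d}" using S[OF inS(2)] abcd(2) by simp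
      moreover have "opp b \<noteq> a" using ab index_opp by metis
      moreover have "opp b \<noteq> b" using ab opp_neq by blast
      moreover have "opp b \<noteq> d" using d ab index_opp by metis
      ultimately have c: "c = opp b" by blast
      show ?thesis
        using ab unfolding abcd(3) c d by blast
    qed
    have "(\<forall>x \<in> darts. \<forall>y \<in> darts. split_index x \<noteq> split_index y \<longrightarrow> ?iso x y) \<longleftrightarrow> ?O \<and> ?C"
    proof (rule iffI)
      show "?O \<and> ?C" if iso: "\<forall>x \<in> darts. \<forall>y \<in> darts. split_index x \<noteq> split_index y \<longrightarrow> ?iso x y"
      proof (intro conjI ballI impI)
        fix x y assume xy: "x \<in> darts" "y \<in> darts" "split_index x \<noteq> split_index y"
        then show "(x, y) \<in> parcs G \<or> (y, x) \<in> parcs G \<or> (x, opp y) \<in> parcs G \<or> (opp y, x) \<in> parcs G"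
        proof -
          obtain a b where ab: "a \<in> darts" "b \<in> darts"
            "parcs G \<inter> {x, opp x, y, opp y} \<times> {x, opp x, y, opp y} = {(a, b), (opp b, opp a)}"
            using iso_imp[OF xy] iso xy by blast
          then have "(a, b) \<in> parcs G" "(opp b, opp a) \<in> parcs G" "a \<in> {x, opp x, y, opp y}" "b \<in> {x, opp x, y, opp y}"
            by blast+
          moreover have "split_index a \<noteq> split_index b"
            using E \<open>(a, b) \<in> parcs G\<close> by blast
          ultimately show ?thesis
            using xy index_opp[of x] index_opp[of y] opp_opp[of x] opp_opp[of y] by auto
        qed
      next
        fix e assume "e \<in> parcs G"
        obtain x y where e: "e = (x, y)" by (cases e)
        have "(x, y) \<in> parcs G" using \<open>e \<in> parcs G\<close> e by simp
        note xy = E[OF this]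
        then have "?iso x y" using iso by blast
        with xy obtain a b where ab: "a \<in> darts" "b \<in> darts"
          "parcs G \<inter> {x, opp x, y, opp y} \<times> {x, opp x, y, opp y} = {(a, b), (opp b, opp a)}"
          using iso_imp by blast
        moreover have "(x, y) \<in> parcs G \<inter> {x, opp x, y, opp y} \<times> {x, opp x, y, opp y}"
          using \<open>(x, y) \<in> parcs G\<close> by blast
        ultimately consider "x = a" "y = b" | "x = opp b" "y = opp a" by auto
        then have "parcs G \<inter> {x, opp x, y, opp y} \<times> {x, opp x, y, opp y} = {(x, y), (opp y, opp x)}"
          unfolding ab(3) by cases (simp_all add: ab(1,2) opp_opp insert_commute)
        then have "(opp y, opp x) \<in> parcs G" "(x, opp y) \<in> parcs G \<Longrightarrow> (x, opp y) \<in> {(x, y), (opp y, opp x)}"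
          by blast+
        then have "(opp y, opp x) \<in> parcs G \<and> (x, opp y) \<notin> parcs G"
          using xy index_opp[of x] index_opp[of y] opp_neq[of y] by auto
        then show "case e of (x, y) \<Rightarrow> (opp y, opp x) \<in> parcs G \<and> (x, opp y) \<notin> parcs G"
          using e by simp
      qed
    next
      assume OC: "?O \<and> ?C"
      show "\<forall>x \<in> darts. \<forall>y \<in> darts. split_index x \<noteq> split_index y \<longrightarrow> ?iso x y"
      proof (intro ballI impI)
        fix x y assume xy: "x \<in> darts" "y \<in> darts" "split_index x \<noteq> split_index y"
        from OC have O: ?O and C: ?C by (rule conjunct1, rule conjunct2)
        have asym: "(q, p) \<notin> parcs G" if "(p, q) \<in> parcs G" for p q
          using E that subset_mset.less_asym by blast
        \<comment> \<open>Renaming reduces the four alternatives to a single arc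
          \<open>(a, b)\<close>; all other candidate arcs are then excluded relative to it.\<close>
        obtain a b where ab: "(a, b) \<in> parcs G" and S: "{x, opp x, y, opp y} = {a, opp a, b, opp b}"
        proof -
          have "(x, y) \<in> parcs G \<or> (y, x) \<in> parcs G \<or> (x, opp y) \<in> parcs G \<or> (opp y, x) \<in> parcs G"
            using C xy by blast
          then show ?thesis
            using that[of x y] that[of y x] that[of x "opp y"] that[of "opp y" x] opp_opp[OF xy(2)]
            by (auto simp: insert_commute)
        qed
        have oo: "opp (opp a) = a" "opp (opp b) = b" and idx: "split_index a \<noteq> split_index b"
          and idx_opp: "split_index (opp a) = split_index a" "split_index (opp b) = split_index b"
          using E[OF ab] opp_opp index_opp by auto
        have O': "(opp q, opp p) \<in> parcs G" "(p, opp q) \<notin> parcs G" if "(p, q) \<in> parcs G" for p q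
          using O that by auto
        have no: "(a, opp b) \<notin> parcs G" "(opp b, a) \<notin> parcs G" "(b, a) \<notin> parcs G"
          "(opp a, b) \<notin> parcs G" "(opp a, opp b) \<notin> parcs G" "(b, opp a) \<notin> parcs G"
          using O'[OF ab] O'[OF O'(1)[OF ab]] asym[OF ab] O'[of "opp a" b] O'[of "opp a" "opp b"] O'[of b "opp a"]
          by (auto simp: oo)
        have same: "(p, q) \<notin> parcs G" if "split_index p = split_index q" for p q
          using E that by blast
        have "parcs G \<inter> {a, opp a, b, opp b} \<times> {a, opp a, b, opp b} = {(a, b), (opp b, opp a)}"
          using ab O'(1)[OF ab] no same idx_opp by auto
        moreover have "{a, opp a, b, opp b} = {a, b, opp b, opp a}"
          by blast
        moreover have "distinct [a, b, opp b, opp a]"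
          using idx idx_opp opp_neq[of a] opp_neq[of b] E[OF ab] by auto
        ultimately show "?iso x y"
          unfolding S digraph_iso_D1_iff
          by (intro exI[of _ a] exI[of _ b] exI[of _ "opp b"] exI[of _ "opp a"] conjI)
      qed
    qed
    then show ?thesis
      by (simp only:)
  qed auto
  finally show ?thesis .
qed

end

section \<open>From trees to consistent thin subgraphs\<close>

text \<open>Serves to list the edges of a tree in the order of \<open>Ss\<close>, so that the
  \<open>i\<close>-th edge induces the \<open>i\<close>-th split even when splits repeat.\<close>

lemma image_mset_eq_mset_obtain:
  assumes "image_mset f A = mset ys"
  obtains xs where "mset xs = A" "map f xs = ys"
proof -
  have "\<exists>xs. mset xs = A \<and> map f xs = ys"
    using assms
  proof (induction ys arbitrary: A)
    case (Cons y ys)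
    then obtain a A' where "A = add_mset a A'" "f a = y" "image_mset f A' = mset ys"
      using msed_map_invR[of f A y "mset ys"] by auto
    then show ?case
      using Cons.IH[of A'] by (metis list.simps(9) mset.simps(2))
  qed auto
  then show ?thesis using that by blast
qed

lemma acyclic_subset_split_containment_graph:
  assumes "E \<subseteq> parcs (split_containment_graph Ss)"
  shows "acyclic E"
proof -
  have "size (part x) < size (part y)" if "(x, y) \<in> E\<^sup>+" for x y
    using that
  proof induction
    case (base y)
    then show ?case using assms by (auto simp: split_containment_graph_def intro: mset_subset_size)
  next
    case (step y z)
    then have "size (part y) < size (part z)"
      using assms by (auto simp: split_containment_graph_def intro: mset_subset_size)
    then show ?case using step.IH by simp
  qed
  then show ?thesis
    unfolding acyclic_def by blast
qed

context split_list
begin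

lemma compatible_imp_consistent_thin:
  fixes T :: "'v pair_pre_digraph"
  assumes MT: "M_tree M T lab" and rep: "represented_system T lab = mset Ss"
  shows "\<exists>G. thin Ss G \<and> consistent G"
proof -
  interpret labelled_tree T M lab
    using MT by unfold_locales (auto simp: M_tree_def)
  let ?W = "\<lambda>p. weight (side (fst p) (snd p))"
  have "edges T \<subseteq> (\<lambda>(u, v). {u, v}) ` parcs T"
    by (auto simp: edges_def)
  then have fin_edges: "finite (edges T)"
    using pair_finite_arcs finite_surj by blast
  obtain es where es: "mset es = mset_set (edges T)" "map (induced_split T lab) es = Ss"
    using rep image_mset_eq_mset_obtain unfolding represented_system_def by metis
  have set_es: "set es = edges T" and len: "length es = length Ss"
    using es fin_edges by (auto simp: set_mset_mset[symmetric] simp del: set_mset_mset)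
  have "distinct es"
    by (rule distinct_count_atmost_1[THEN iffD2]) (auto simp: es(1) set_es fin_edges simp flip: count_mset)
  obtain rep where rep: "\<And>i. i < length Ss \<Longrightarrow> rep i \<in> darts \<and> split_index (rep i) = i"
    using ex_dart by metis
  \<comment> \<open>The induced split is unordered, so one of the two orientations of the edge has
    to be matched with \<open>rep i\<close>; if both parts coincide, either orientation is
    right.\<close>
  have "\<exists>p. p \<in> parcs T \<and> {fst p, snd p} = es ! i \<and> part (rep i) = ?W p \<and> part (opp (rep i)) = ?W (prod.swap p)"
    if i: "i < length Ss" for i
  proof -
    have "es ! i \<in> edges T" using set_es len i nth_mem by metis
    then obtain u v where uv: "(u, v) \<in> parcs T" "es ! i = {u, v}"
      by (auto simp: edges_def)
    have "Ss ! i = induced_split T lab {u, v}"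
      using es(2) uv(2) len i by (metis nth_map)
    then have "{#part (rep i), part (opp (rep i))#} = {#?W (u, v), ?W (v, u)#}"
      using split_eq[of "rep i"] rep[OF i] induced_split_eq[OF uv(1), of lab] by simp
    then show ?thesis
      unfolding add_mset_doubleton_eq_iff
    proof (elim disjE)
      assume "part (rep i) = ?W (u, v) \<and> part (opp (rep i)) = ?W (v, u)"
      then show ?thesis using uv by (intro exI[of _ "(u, v)"]) simp
    next
      assume "part (rep i) = ?W (v, u) \<and> part (opp (rep i)) = ?W (u, v)"
      then show ?thesis using uv arcs_symmetric[OF uv(1)] by (intro exI[of _ "(v, u)"]) (simp add: insert_commute)
    qed
  qed
  then obtain \<psi> where \<psi>: "\<And>i. i < length Ss \<Longrightarrow> \<psi> i \<in> parcs T \<and> {fst (\<psi> i), snd (\<psi> i)} = es ! i \<and>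
      part (rep i) = ?W (\<psi> i) \<and> part (opp (rep i)) = ?W (prod.swap (\<psi> i))"
    by metis
  \<comment> \<open>Extending by reversal makes \<open>opp\<close> correspond to swapping the ends
    of the edge, also for splits \<open>A|A\<close>.\<close>
  define \<phi> where "\<phi> x = (if x = rep (split_index x) then \<psi> (split_index x) else prod.swap (\<psi> (split_index x)))" for x
  have x_cases: "x = rep (split_index x) \<or> x = opp (rep (split_index x))" if "x \<in> darts" for x
    using that rep[OF index_less[OF that]] same_index by metis
  have \<phi>: "\<phi> x \<in> parcs T \<and> {fst (\<phi> x), snd (\<phi> x)} = es ! split_index x \<and> part x = ?W (\<phi> x)
      \<and> \<phi> (opp x) = prod.swap (\<phi> x)" if x: "x \<in> darts" for x
  proof (cases "x = rep (split_index x)")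
    case True
    then have "\<phi> x = \<psi> (split_index x)" "part x = part (rep (split_index x))"
      by (auto simp: \<phi>_def)
    moreover have "\<phi> (opp x) = prod.swap (\<psi> (split_index x))"
      using True opp_neq[OF x] by (auto simp: \<phi>_def index_opp[OF x])
    ultimately show ?thesis
      using \<psi>[OF index_less[OF x]] by simp
  next
    case False
    then have eq: "x = opp (rep (split_index x))" using x_cases x by blast
    then have "opp x = rep (split_index x)"
      using opp_opp rep[OF index_less[OF x]] by metis
    then have "\<phi> (opp x) = \<psi> (split_index x)"
      unfolding \<phi>_def index_opp[OF x] by simp
    moreover have "\<phi> x = prod.swap (\<psi> (split_index x))"
      using False by (simp add: \<phi>_def)
    moreover have "part x = part (opp (rep (split_index x)))" using eq by simp
    ultimately show ?thesis
      using \<psi>[OF index_less[OF x]] arcs_symmetric[of "fst (\<psi> (split_index x))" "snd (\<psi> (split_index x))"]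
      by (simp add: insert_commute prod.swap_def)
  qed
  define S where "S x = side (fst (\<phi> x)) (snd (\<phi> x))" for x
  have arc: "(fst (\<phi> x), snd (\<phi> x)) \<in> parcs T" if "x \<in> darts" for x
    using \<phi>[OF that] by simp
  have S_opp: "S (opp x) = pverts T - S x" if "x \<in> darts" for x
    using \<phi>[OF that] side_compl[OF arc[OF that]] by (simp add: S_def)
  have S_rev: "side (snd (\<phi> x)) (fst (\<phi> x)) = S (opp x)" if "x \<in> darts" for x
    using \<phi>[OF that] by (simp add: S_def)
  have S_sub: "S x \<subseteq> pverts T" if "x \<in> darts" for x
    using side_Un[OF arc[OF that]] by (auto simp: S_def)
  have S_ne: "S x \<noteq> {}" if "x \<in> darts" for x
    using start_in_side by (auto simp: S_def)
  have part_S: "part x = weight (S x)" if "x \<in> darts" for x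
    using \<phi>[OF that] by (simp add: S_def)
  have S_nested: "S y \<subset> S x \<or> S x \<subset> S y \<or> S y \<subset> S (opp x) \<or> S (opp y) \<subset> S x"
    if "x \<in> darts" "y \<in> darts" "split_index x \<noteq> split_index y" for x y
  proof -
    have "es ! split_index x \<noteq> es ! split_index y"
      using \<open>distinct es\<close> that index_less len by (simp add: nth_eq_iff_index_eq)
    then have ne: "{fst (\<phi> x), snd (\<phi> x)} \<noteq> {fst (\<phi> y), snd (\<phi> y)}"
      using \<phi>[OF that(1)] \<phi>[OF that(2)] by metis
    have "S y \<subset> S x \<or> S y \<subset> S (opp x) \<or> S (opp y) \<subset> S x \<or> S (opp y) \<subset> S (opp x)"
      using nested_sides[OF arc[OF that(1)] arc[OF that(2)] ne]
      unfolding S_rev[OF that(1)] S_rev[OF that(2)] S_def[symmetric] .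
    moreover have "S x \<subset> S y" if "S (opp y) \<subset> S (opp x)"
      using that unfolding S_opp[OF \<open>x \<in> darts\<close>] S_opp[OF \<open>y \<in> darts\<close>]
      using S_sub[OF \<open>x \<in> darts\<close>] S_sub[OF \<open>y \<in> darts\<close>] by blast
    ultimately show ?thesis by blast
  qed
  define G where "G = \<lparr>pverts = darts,
    parcs = {(x, y) \<in> darts \<times> darts. split_index x \<noteq> split_index y \<and> S x \<subset> S y}\<rparr>"
  have G: "(x, y) \<in> parcs G \<longleftrightarrow> x \<in> darts \<and> y \<in> darts \<and> split_index x \<noteq> split_index y \<and> S x \<subset> S y" for x y
    by (auto simp: G_def)
  have sub: "parcs G \<subseteq> parcs (split_containment_graph Ss)"
    using weight_side_strict_mono[OF arc arc] part_S
    by (auto simp: G split_containment_graph_def S_def)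
  have "thin Ss G"
    unfolding thin_iff
  proof (intro conjI ballI impI)
    show "pverts G = darts" by (simp add: G_def)
    show "case e of (x, y) \<Rightarrow> (opp y, opp x) \<in> parcs G \<and> (x, opp y) \<notin> parcs G" if "e \<in> parcs G" for e
    proof -
      obtain x y where e: "e = (x, y)" by (cases e)
      then have xy: "x \<in> darts" "y \<in> darts" "split_index x \<noteq> split_index y" "S x \<subset> S y"
        using that G by auto
      then have "S (opp y) \<subset> S (opp x)" "\<not> S x \<subset> S (opp y)"
        using S_opp[OF xy(1)] S_opp[OF xy(2)] S_sub[OF xy(1)] S_sub[OF xy(2)] S_ne[OF xy(1)] by auto
      then show ?thesis
        using e xy opp_in_darts index_opp G by simp
    qed
    show "(x, y) \<in> parcs G \<or> (y, x) \<in> parcs G \<or> (x, opp y) \<in> parcs G \<or> (opp y, x) \<in> parcs G"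
      if xy: "x \<in> darts" "y \<in> darts" "split_index x \<noteq> split_index y" for x y
    proof -
      have "S y \<subset> S (opp x) \<Longrightarrow> S x \<subset> S (opp y)"
        using S_opp[OF xy(1)] S_opp[OF xy(2)] S_sub[OF xy(1)] S_sub[OF xy(2)] by auto
      then show ?thesis
        using S_nested[OF xy] xy opp_in_darts index_opp unfolding G by metis
    qed
  qed (rule sub)
  moreover have "consistent G"
    unfolding consistent_def
  proof
    fix x assume "x \<in> pverts G"
    then have x: "x \<in> darts" by (simp add: G_def)
    have wf: "pair_wf_digraph G"
      by unfold_locales (auto simp: G_def)
    have C: "y \<in> darts \<and> S y \<subset> S x \<and> (\<forall>z. \<not> ((y, z) \<in> parcs G \<and> (z, x) \<in> parcs G)) \<and> (y, x) \<in> parcs G"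
      if "y \<in> critical_preds G x" for y
    proof -
      have "(y, x) \<in> parcs G" "\<nexists>z. (y, z) \<in> (parcs G)\<^sup>+ \<and> (z, x) \<in> (parcs G)\<^sup>+"
        using that critical_iff[OF wf acyclic_subset_split_containment_graph[OF sub], of y x]
        by (simp_all add: critical_preds_def)
      then show ?thesis
        using G by blast
    qed
    \<comment> \<open>Of the four ways two sides can be nested, only disjointness survives:
      criticality forbids containment either way, and both lie in \<open>S x\<close>, so together
      they cannot cover the tree.\<close>
    have disj: "S y \<inter> S y' = {}" if y: "y \<in> critical_preds G x" and y': "y' \<in> critical_preds G x" and "y \<noteq> y'" for y y'
    proof (cases "split_index y = split_index y'")
      case True
      then have "y' = opp y" using same_index C y y' \<open>y \<noteq> y'\<close> by metis
      then show ?thesis using S_opp C[OF y] by blast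
    next
      case False
      have d: "y \<in> darts" "y' \<in> darts" and sub: "S y \<subset> S x" "S y' \<subset> S x" using C y y' by auto
      have "\<not> S y' \<subset> S y" "\<not> S y \<subset> S y'"
        using C[OF y] C[OF y'] False G by metis+
      moreover have "\<not> S (opp y') \<subset> S y"
      proof
        assume "S (opp y') \<subset> S y"
        then have "pverts T \<subseteq> S x"
          unfolding S_opp[OF d(2)] using sub by blast
        then have "S (opp x) = {}"
          using S_opp[OF x] by simp
        then show False
          using S_ne[OF opp_in_darts[OF x]] by blast
      qed
      ultimately have "S y' \<subset> S (opp y)"
        using S_nested[OF d False] by blast
      then show ?thesis
        using S_opp[OF d(1)] by blast
    qed
    have fin: "finite (S z)" if "z \<in> darts" for z
      using S_sub[OF that] pair_finite_verts finite_subset by blast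
    have "finite (critical_preds G x)"
      using finite_darts by (auto simp: critical_preds_def G_def)
    then have "weight (\<Union>y\<in>critical_preds G x. S y) = (\<Sum>y\<in>critical_preds G x. weight (S y))"
      using fin C disj by (intro sum.UNION_disjoint) auto
    also have "\<dots> = (\<Sum>y\<in>critical_preds G x. part y)"
      using C part_S by (intro sum.cong) auto
    finally have "(\<Sum>y\<in>critical_preds G x. part y) = weight (\<Union>y\<in>critical_preds G x. S y)" ..
    moreover have "weight (S x) = weight (S x - (\<Union>y\<in>critical_preds G x. S y)) + weight (\<Union>y\<in>critical_preds G x. S y)"
    proof (rule sum.subset_diff)
      show "(\<Union>y\<in>critical_preds G x. S y) \<subseteq> S x" using C by blast
    qed (rule fin[OF x])
    ultimately show "(\<Sum>y\<in>critical_preds G x. part y) \<subseteq># part x"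
      using part_S[OF x] by simp
  qed
  ultimately show ?thesis by blast
qed

end

section \<open>Transitivity of consistent thin subgraphs\<close>

text \<open>What remains of a consistent thin subgraph when the triples are forgotten. Four
  alternatives suffice in \<open>E_total\<close> because \<open>E_bar\<close> yields their mirror
  images. The last assumption speaks of \<open>E\<^sup>+\<close>, since before transitivity is known
  a critical arc excludes detours of any length.\<close>

locale thin_order =
  fixes D :: "'d set" and bar :: "'d \<Rightarrow> 'd" and E :: "'d rel"
    and M :: "'a multiset" and \<mu> :: "'d \<Rightarrow> 'a multiset"
  assumes finite_D: "finite D"
    and bar_in: "x \<in> D \<Longrightarrow> bar x \<in> D"
    and bar_bar: "x \<in> D \<Longrightarrow> bar (bar x) = x"
    and bar_neq: "x \<in> D \<Longrightarrow> bar x \<noteq> x"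
    and E_D: "(x, y) \<in> E \<Longrightarrow> x \<in> D \<and> y \<in> D"
    and E_neq: "(x, y) \<in> E \<Longrightarrow> y \<noteq> bar x"
    and E_part: "(x, y) \<in> E \<Longrightarrow> \<mu> x \<subset># \<mu> y"
    and E_bar: "(x, y) \<in> E \<Longrightarrow> (bar y, bar x) \<in> E"
    and E_no: "(x, y) \<in> E \<Longrightarrow> (x, bar y) \<notin> E"
    and E_total: "x \<in> D \<Longrightarrow> y \<in> D \<Longrightarrow> y \<noteq> x \<Longrightarrow> y \<noteq> bar x \<Longrightarrow>
      (x, y) \<in> E \<or> (y, x) \<in> E \<or> (x, bar y) \<in> E \<or> (bar y, x) \<in> E"
    and part_bar: "x \<in> D \<Longrightarrow> \<mu> x + \<mu> (bar x) = M"
    and part_ne: "x \<in> D \<Longrightarrow> \<mu> x \<noteq> {#}"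
    and consistent_preds: "x \<in> D \<Longrightarrow>
      (\<Sum>y\<in>{y. (y, x) \<in> E \<and> \<not> (\<exists>z. (y, z) \<in> E\<^sup>+ \<and> (z, x) \<in> E\<^sup>+)}. \<mu> y) \<subseteq># \<mu> x"
begin

abbreviation rank :: "'d \<Rightarrow> nat" where "rank x \<equiv> size (\<mu> x)"

lemma rank_bar: "x \<in> D \<Longrightarrow> rank x + rank (bar x) = size M"
  using part_bar by (metis size_union)

lemma rank_pos: "x \<in> D \<Longrightarrow> rank x > 0"
  using part_ne by (simp add: nonempty_has_size)

lemma rank_less: "(x, y) \<in> E \<Longrightarrow> rank x < rank y"
  using E_part by (simp add: mset_subset_size)

lemma trancl_D: "(x, y) \<in> E\<^sup>+ \<Longrightarrow> x \<in> D \<and> y \<in> D"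
  by (induction rule: trancl_induct) (auto dest: E_D)

lemma trancl_rank: "(x, y) \<in> E\<^sup>+ \<Longrightarrow> rank x < rank y"
  by (induction rule: trancl_induct) (use rank_less in \<open>fastforce+\<close>)

lemma rtrancl_rank: "(x, y) \<in> E\<^sup>* \<Longrightarrow> rank x \<le> rank y"
  using trancl_rank by (metis less_imp_le order_refl rtranclD)

lemma trancl_bar: "(x, y) \<in> E\<^sup>+ \<Longrightarrow> (bar y, bar x) \<in> E\<^sup>+"
  by (induction rule: trancl_induct) (auto dest: E_bar intro: trancl_into_trancl2)

lemma rtrancl_bar: "(x, y) \<in> E\<^sup>* \<Longrightarrow> (bar y, bar x) \<in> E\<^sup>*"
  using trancl_bar by (metis rtrancl_eq_or_trancl)

abbreviation preds :: "'d \<Rightarrow> 'd set" where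
  "preds x \<equiv> {y. (y, x) \<in> E \<and> \<not> (\<exists>z. (y, z) \<in> E\<^sup>+ \<and> (z, x) \<in> E\<^sup>+)}"

lemma finite_preds: "finite (preds x)"
  by (rule finite_subset[OF _ finite_D]) (auto dest: E_D)

text \<open>Among the in-neighbours of \<open>w\<close> that \<open>p\<close> reaches, one of
  maximal rank is critical: a detour from it to \<open>w\<close> would enter \<open>w\<close>
  through another such in-neighbour of larger rank.\<close>

lemma pred_above:
  assumes "(p, w) \<in> E\<^sup>+"
  shows "\<exists>c \<in> preds w. (p, c) \<in> E\<^sup>*"
proof -
  let ?P = "\<lambda>c. (p, c) \<in> E\<^sup>* \<and> (c, w) \<in> E"
  have "\<exists>c. ?P c"
    using assms by (metis tranclD2)
  moreover have "\<forall>c. ?P c \<longrightarrow> rank c < rank w"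
    using rank_less by blast
  ultimately obtain c where c: "?P c" and max: "\<And>c'. ?P c' \<Longrightarrow> rank c' \<le> rank c"
    using ex_has_greatest_nat[of ?P _ rank "rank w"] by blast
  have "\<not> (\<exists>z. (c, z) \<in> E\<^sup>+ \<and> (z, w) \<in> E\<^sup>+)"
  proof
    assume "\<exists>z. (c, z) \<in> E\<^sup>+ \<and> (z, w) \<in> E\<^sup>+"
    then obtain z where z: "(c, z) \<in> E\<^sup>+" "(z, w) \<in> E\<^sup>+" by blast
    then obtain z' where z': "(z, z') \<in> E\<^sup>*" "(z', w) \<in> E"
      by (metis tranclD2)
    have "(p, z') \<in> E\<^sup>*"
      using c z(1) z'(1) by (meson rtrancl_trans trancl_into_rtrancl)
    then have "rank z' \<le> rank c"
      using max z'(2) by blast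
    then show False
      using trancl_rank[OF z(1)] rtrancl_rank[OF z'(1)] by simp
  qed
  then show ?thesis using c by blast
qed

text \<open>Follow critical arcs from \<open>p\<close> and from \<open>q\<close> until the two chains meet: at the meeting point
  they come from distinct critical predecessors, whose parts are jointly bounded by consistency.\<close>

lemma ancestors_comparable_or_small:
  "(p, w) \<in> E\<^sup>+ \<Longrightarrow> (q, w) \<in> E\<^sup>+ \<Longrightarrow> (p, q) \<in> E\<^sup>* \<or> (q, p) \<in> E\<^sup>* \<or> rank p + rank q \<le> rank w"
proof (induction "rank w" arbitrary: w rule: less_induct)
  case less
  obtain c d where c: "c \<in> preds w" "(p, c) \<in> E\<^sup>*" and d: "d \<in> preds w" "(q, d) \<in> E\<^sup>*"
    using pred_above less.prems by meson
  show ?case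
  proof (cases "c = d")
    case True
    show ?thesis
    proof (cases "p = c \<or> q = c")
      case True
      then show ?thesis using c d \<open>c = d\<close> by auto
    next
      case False
      then have "(p, c) \<in> E\<^sup>+" "(q, c) \<in> E\<^sup>+"
        using c d \<open>c = d\<close> by (auto simp: rtrancl_eq_or_trancl)
      moreover have "rank c < rank w"
        using c(1) rank_less by blast
      ultimately show ?thesis
        using less.hyps[of c] by auto
    qed
  next
    case False
    have "(\<Sum>y\<in>preds w. \<mu> y) = (\<Sum>y\<in>preds w - {c, d}. \<mu> y) + (\<Sum>y\<in>{c, d}. \<mu> y)"
      using c(1) d(1) finite_preds by (intro sum.subset_diff) auto
    then have "\<mu> c + \<mu> d \<subseteq># (\<Sum>y\<in>preds w. \<mu> y)"
      using False by (simp del: mem_Collect_eq)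
    also have "\<dots> \<subseteq># \<mu> w"
      using consistent_preds trancl_D less.prems by blast
    finally have "rank c + rank d \<le> rank w"
      using size_mset_mono by fastforce
    then show ?thesis
      using rtrancl_rank[OF c(2)] rtrancl_rank[OF d(2)] by linarith
  qed
qed

text \<open>A path from \<open>p\<close> to \<open>bar p\<close> and its image under \<open>bar\<close> have the same ends; comparing them
  near \<open>bar p\<close> yields such a path for a dart with a larger part.\<close>

lemma no_path_to_bar: "(p, bar p) \<notin> E\<^sup>+"
\<comment> \<open>\<open>rank p\<close> stays below \<open>size M\<close>, as \<open>bar p\<close>
  has a nonempty part; the measure therefore drops whenever the part grows.\<close>
proof (induction "size M - rank p" arbitrary: p rule: less_induct)
  case less
  show ?case
  proof
    assume path: "(p, bar p) \<in> E\<^sup>+"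
    then have p: "p \<in> D" using trancl_D by blast
    have IH: "(r, bar r) \<notin> E\<^sup>+" if "rank p < rank r" "r \<in> D" for r
      using that rank_bar[of r] rank_pos[OF bar_in[of r]] by (intro less.hyps) linarith
    obtain p1 where p1: "(p, p1) \<in> E" "(p1, bar p) \<in> E\<^sup>*"
      using path by (metis tranclD)
    have "p1 \<noteq> bar p" using E_neq p1(1) by blast
    then have p1': "(p1, bar p) \<in> E\<^sup>+" using p1(2) by (simp add: rtrancl_eq_or_trancl)
    then obtain pk where pk: "(p1, pk) \<in> E\<^sup>*" "(pk, bar p) \<in> E"
      by (metis tranclD2)
    have D: "p1 \<in> D" "pk \<in> D" using E_D p1(1) pk(2) by blast+
    have p_pk: "(p, bar pk) \<in> E"
      using E_bar[OF pk(2)] bar_bar[OF p] by simp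
    \<comment> \<open>The path starts with \<open>(p, p1)\<close>, its mirror image with
      \<open>(p, bar pk)\<close>; for \<open>p1 = pk\<close> both arcs would be present, against
      \<open>E_no\<close>.\<close>
    have "p1 \<noteq> pk" using p_pk E_no p1(1) by blast
    then have p1_pk: "(p1, pk) \<in> E\<^sup>+" using pk(1) by (simp add: rtrancl_eq_or_trancl)
    have "(bar p1, bar p) \<in> E\<^sup>+" "(pk, bar p) \<in> E\<^sup>+"
      using E_bar[OF p1(1)] pk(2) by auto
    then consider "(pk, bar p1) \<in> E\<^sup>*" | "(bar p1, pk) \<in> E\<^sup>*" | "rank pk + rank (bar p1) \<le> rank (bar p)"
      using ancestors_comparable_or_small by blast
    \<comment> \<open>A path from \<open>pk\<close> to \<open>bar p1\<close> leads from
      \<open>p1\<close> to \<open>bar p1\<close>; a path from \<open>bar p1\<close> to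
      \<open>pk\<close> mirrors to one from \<open>bar pk\<close> to \<open>p1\<close> and on to
      \<open>pk\<close>. Both \<open>p1\<close> and \<open>bar pk\<close> have larger parts than
      \<open>p\<close>. In the last case \<open>rank pk > rank p1\<close> pushes the sum above
      \<open>size M\<close>, while \<open>rank (bar p)\<close> is below it.\<close>
    then show False
    proof cases
      case 1
      then have "(p1, bar p1) \<in> E\<^sup>+" using p1_pk by (meson trancl_rtrancl_trancl)
      then show False using IH rank_less[OF p1(1)] D by blast
    next
      case 2
      then have "(bar pk, p1) \<in> E\<^sup>*" using rtrancl_bar bar_bar D by metis
      then have "(bar pk, bar (bar pk)) \<in> E\<^sup>+"
        using p1_pk bar_bar D by (metis rtrancl_trancl_trancl)
      then show False using IH[OF rank_less[OF p_pk]] bar_in D by blast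
    next
      case 3
      then show False
        using trancl_rank[OF p1_pk] rank_bar[OF D(1)] rank_bar[OF p] rank_pos[OF p] by linarith
    qed
  qed
qed

text \<open>Some arc must relate the splits of \<open>x\<close> and \<open>z\<close>. An arc
  \<open>(z, x)\<close> contradicts sizes, and each of the other two wrong choices closes up with
  the path from \<open>x\<close> to \<open>z\<close> to a path from a dart to its own
  \<open>bar\<close>.\<close>

lemma E_trans: "(x, y) \<in> E \<Longrightarrow> (y, z) \<in> E \<Longrightarrow> (x, z) \<in> E"
proof -
  assume xy: "(x, y) \<in> E" and yz: "(y, z) \<in> E"
  then have xz: "(x, z) \<in> E\<^sup>+" by simp
  have D: "x \<in> D" "z \<in> D" using E_D xy yz by blast+
  have "z \<noteq> x" using trancl_rank[OF xz] by auto
  moreover have "z \<noteq> bar x" using xz no_path_to_bar by blast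
  moreover have "(z, x) \<notin> E" using trancl_rank[OF xz] rank_less[of z x] by auto
  moreover have "(x, bar z) \<notin> E"
  proof
    assume "(x, bar z) \<in> E"
    then have "(z, bar x) \<in> E" using E_bar bar_bar D by metis
    then show False using xz no_path_to_bar by (meson trancl_into_trancl)
  qed
  moreover have "(bar z, x) \<notin> E"
  proof
    assume "(bar z, x) \<in> E"
    then have "(bar z, bar (bar z)) \<in> E\<^sup>+" using xz bar_bar D by (metis trancl_into_trancl2)
    then show False using no_path_to_bar by blast
  qed
  ultimately show "(x, z) \<in> E"
    using E_total D by blast
qed

lemma trancl_E: "E\<^sup>+ = E"
  using E_trans by (intro trancl_id transI)

section \<open>The covering relation of the order and the relation of having a common head\<close>

definition crit :: "'d \<Rightarrow> 'd \<Rightarrow> bool" where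
  "crit y x \<longleftrightarrow> (y, x) \<in> E \<and> \<not> (\<exists>z. (y, z) \<in> E \<and> (z, x) \<in> E)"

lemma critD: "crit y x \<Longrightarrow> (y, x) \<in> E"
  by (simp add: crit_def)

lemma consistent_crit: "x \<in> D \<Longrightarrow> (\<Sum>y | crit y x. \<mu> y) \<subseteq># \<mu> x"
  using consistent_preds by (simp add: trancl_E crit_def)

lemma finite_crit: "finite {y. crit y x}"
  using finite_preds by (simp add: trancl_E crit_def)

lemma crit_bar: "crit y x \<Longrightarrow> crit (bar x) (bar y)"
  unfolding crit_def using E_bar E_D bar_bar by metis

lemma crit_below:
  assumes "(z, x) \<in> E"
  obtains c where "crit c x" "z = c \<or> (z, c) \<in> E"
  using pred_above[of z x] assms that
  by (auto simp: trancl_E crit_def rtrancl_eq_or_trancl)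

lemma crit_above:
  assumes "(z, x) \<in> E"
  obtains c where "crit z c" "c = x \<or> (c, x) \<in> E"
proof -
  obtain c where c: "crit c (bar z)" "bar x = c \<or> (bar x, c) \<in> E"
    using crit_below[OF E_bar[OF assms]] .
  have D: "z \<in> D" "x \<in> D" "c \<in> D" using assms c(1) E_D critD by blast+
  have "crit z (bar c)" using crit_bar[OF c(1)] bar_bar[OF D(1)] by simp
  moreover have "bar c = x \<or> (bar c, x) \<in> E"
    using c(2) E_bar[of "bar x" c] bar_bar[OF D(2)] by auto
  ultimately show ?thesis using that by blast
qed

lemma E_asym: "(x, y) \<in> E \<Longrightarrow> (y, x) \<notin> E"
  using rank_less by (meson less_asym)

lemma E_no': "(x, y) \<in> E \<Longrightarrow> (bar x, y) \<notin> E"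
  using E_bar E_no E_D bar_bar by metis

text \<open>The relation \<open>x = y \<or> crit x (bar y)\<close> is to mean that \<open>x\<close>
  and \<open>y\<close> point to the same vertex; this is its transitivity. Every other position of
  \<open>x\<close> relative to \<open>z\<close> contradicts covering or \<open>E_no\<close>, and an
  element between \<open>x\<close> and \<open>bar z\<close> could not be compared with
  \<open>y\<close> in any way.\<close>

lemma crit_eq_trans:
  assumes xy: "crit x (bar y)" and yz: "crit y (bar z)" and "x \<noteq> z" and D: "y \<in> D" "z \<in> D"
  shows "crit x (bar z)"
proof -
  have x: "x \<in> D" using xy critD E_D by blast
  note E = critD[OF xy] critD[OF yz]
  have yx: "crit y (bar x)" using crit_bar[OF xy] bar_bar[OF D(1)] by simp
  have zy: "crit z (bar y)" using crit_bar[OF yz] bar_bar[OF D(2)] by simp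
  have "z \<noteq> bar x"
    using critD[OF yx] critD[OF yz] E_no[of y "bar x"] by (metis bar_bar x)
  moreover have "(x, z) \<notin> E"
    using zy E_bar[of x z] yx yz by (auto simp: crit_def)
  moreover have "(z, x) \<notin> E"
    using xy zy E_bar[of z x] yx yz by (auto simp: crit_def)
  moreover have "(bar z, x) \<notin> E"
    using E_trans[OF critD[OF yz]] critD[OF yx] E_no[of y x] bar_bar x by metis
  ultimately have xz: "(x, bar z) \<in> E"
    using E_total[OF x D(2)] \<open>x \<noteq> z\<close> by blast
  show ?thesis
    unfolding crit_def
  proof (intro conjI xz notI)
    assume "\<exists>w. (x, w) \<in> E \<and> (w, bar z) \<in> E"
    then obtain w where w: "(x, w) \<in> E" "(w, bar z) \<in> E" by blast
    have wD: "w \<in> D" using w E_D by blast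
    have "(y, w) \<notin> E" using yz w(2) by (auto simp: crit_def)
    moreover have "(w, y) \<notin> E" using E_trans[OF w(1)] E(1) E_no[of x y] by blast
    moreover have "(bar y, w) \<notin> E"
      using E_trans[of "bar y" w "bar z"] w(2) E_no'[OF E(2)] by blast
    moreover have "(w, bar y) \<notin> E" using xy w(1) by (auto simp: crit_def)
    moreover have "w \<noteq> y" using w(1) E(1) E_no by blast
    moreover have "w \<noteq> bar y" using w(2) E(2) E_no' by blast
    moreover have "(y, bar w) \<in> E \<Longrightarrow> (w, bar y) \<in> E" "(bar w, y) \<in> E \<Longrightarrow> (bar y, w) \<in> E"
      using E_bar bar_bar wD by metis+
    ultimately show False
      using E_total[OF D(1) wD] by blast
  qed
qed

lemma crit_sym: "crit x (bar y) \<Longrightarrow> y \<in> D \<Longrightarrow> crit y (bar x)"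
  using crit_bar bar_bar by metis

text \<open>The heads are the equivalence classes, numbered by an injection because the trees of
  \<open>compatible_system\<close> have natural numbers as vertices.\<close>

lemma head_exists:
  "\<exists>h :: 'd \<Rightarrow> nat. \<forall>x \<in> D. \<forall>y \<in> D. h x = h y \<longleftrightarrow> x = y \<or> crit x (bar y)"
proof -
  define cls where "cls x = {y \<in> D. x = y \<or> crit x (bar y)}" for x
  have cls: "cls x = cls y \<longleftrightarrow> x = y \<or> crit x (bar y)" if xy: "x \<in> D" "y \<in> D" for x y
  proof
    assume "cls x = cls y"
    moreover have "y \<in> cls y" using xy by (simp add: cls_def)
    ultimately show "x = y \<or> crit x (bar y)" by (auto simp: cls_def)
  next
    assume eq: "x = y \<or> crit x (bar y)"
    have "z \<in> cls x \<longleftrightarrow> z \<in> cls y" if "z \<in> D" for z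
      using eq crit_sym[of x y] crit_eq_trans[of x y z] crit_eq_trans[of y x z] xy that
      by (auto simp: cls_def)
    then show "cls x = cls y" by (auto simp: cls_def)
  qed
  obtain g :: "'d set \<Rightarrow> nat" where "inj_on g (cls ` D)"
    using finite_imp_inj_to_nat_seg[of "cls ` D"] finite_D by blast
  then have "\<forall>x \<in> D. \<forall>y \<in> D. g (cls x) = g (cls y) \<longleftrightarrow> x = y \<or> crit x (bar y)"
    using cls by (metis imageI inj_on_eq_iff)
  then show ?thesis
    by (intro exI[of _ "\<lambda>x. g (cls x)"])
qed

end

section \<open>The tree of a consistent thin subgraph\<close>

locale thin_order_head = thin_order D bar E M \<mu>
  for D :: "'d set" and bar :: "'d \<Rightarrow> 'd" and E :: "'d rel"
    and M :: "'a multiset" and \<mu> :: "'d \<Rightarrow> 'a multiset" +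
  fixes h :: "'d \<Rightarrow> nat"
  assumes h_eq: "x \<in> D \<Longrightarrow> y \<in> D \<Longrightarrow> h x = h y \<longleftrightarrow> x = y \<or> crit x (bar y)"
    and D_ne: "D \<noteq> {}"
begin

definition T :: "nat pair_pre_digraph" where
  "T = \<lparr>pverts = h ` D, parcs = (\<lambda>x. (h (bar x), h x)) ` D\<rparr>"

text \<open>Meant to be the tail side of \<open>x\<close>: every vertex there is the tail of a dart
  that leads to \<open>x\<close>. That it is a component is \<open>components_T\<close>.\<close>

definition behind :: "'d \<Rightarrow> nat set" where
  "behind x = (\<lambda>y. h (bar y)) ` {y \<in> D. y = x \<or> (y, x) \<in> E}"

text \<open>The subtraction is never truncated at a vertex of the tree: this is what consistency
  says, see \<open>lab_tail\<close>.\<close>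

definition lab :: "nat \<Rightarrow> 'a multiset" where
  "lab v = M - (\<Sum>x | x \<in> D \<and> h x = v. \<mu> x)"

section \<open>The cut belonging to a dart\<close>

lemma behindI: "y \<in> D \<Longrightarrow> y = x \<or> (y, x) \<in> E \<Longrightarrow> h (bar y) \<in> behind x"
  by (auto simp: behind_def)

lemma tail_behind: "x \<in> D \<Longrightarrow> h (bar x) \<in> behind x"
  by (simp add: behindI)

lemma head_behind_bar: "x \<in> D \<Longrightarrow> h x \<in> behind (bar x)"
  using tail_behind[of "bar x"] bar_in bar_bar by simp

lemma head_tail_neq: "x \<in> D \<Longrightarrow> h (bar x) \<noteq> h x"
  using h_eq[of "bar x" x] bar_in bar_neq by (auto simp: crit_def dest: E_part)

text \<open>Two distinct darts with the same ends would satisfy \<open>(x, bar y) \<in> E\<close>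
  and \<open>(bar x, y) \<in> E\<close>; the mirror image of the first is the reverse of the
  second.\<close>

lemma arc_inj:
  assumes "x \<in> D" "y \<in> D" "h (bar x) = h (bar y)" "h x = h y"
  shows "x = y"
proof (rule ccontr)
  assume "x \<noteq> y"
  then have "crit x (bar y)"
    using h_eq assms by blast
  moreover have "bar x \<noteq> bar y"
    using \<open>x \<noteq> y\<close> bar_bar assms by metis
  then have "crit (bar x) (bar (bar y))"
    using h_eq[of "bar x" "bar y"] bar_in assms by blast
  ultimately show False
    using E_no'[OF critD] critD E_bar bar_bar assms by (metis E_asym)
qed

text \<open>The head of \<open>w\<close> is the tail of any dart covering \<open>w\<close>, and one
  such dart lies below or at \<open>x\<close>.\<close>

lemma head_behind:
  assumes "(w, x) \<in> E"
  shows "h w \<in> behind x"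
proof -
  obtain c where c: "crit w c" "c = x \<or> (c, x) \<in> E"
    using crit_above[OF assms] .
  have D: "w \<in> D" "c \<in> D" using c(1) critD E_D by blast+
  have "h w = h (bar c)"
    using h_eq[OF D(1) bar_in[OF D(2)]] c(1) bar_bar[OF D(2)] by simp
  then show ?thesis
    using behindI[OF D(2)] c(2) by simp
qed

text \<open>For \<open>y\<close> up to \<open>x\<close> and \<open>z\<close> up to
  \<open>bar x\<close> with a common tail, either \<open>y = z\<close>, against \<open>E_no\<close>,
  or \<open>bar z\<close> is below \<open>y\<close>, although it is above or equal to
  \<open>x\<close>.\<close>

lemma behind_disjoint:
  assumes x: "x \<in> D"
  shows "behind x \<inter> behind (bar x) = {}"
proof (rule ccontr)
  assume "behind x \<inter> behind (bar x) \<noteq> {}"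
  then obtain y z where yz: "y \<in> D" "z \<in> D" "h (bar y) = h (bar z)"
    and y: "y = x \<or> (y, x) \<in> E" and z: "z = bar x \<or> (z, bar x) \<in> E"
    by (auto simp: behind_def)
  have "bar y = bar z \<or> crit (bar y) (bar (bar z))"
    using h_eq bar_in yz by blast
  then show False
  proof
    assume "bar y = bar z"
    then have "y = z" using bar_bar yz by metis
    then show False using y z E_no bar_neq[OF x] E_neq bar_bar[OF x]
      by metis
  next
    assume "crit (bar y) (bar (bar z))"
    then have "(bar z, y) \<in> E"
      using critD E_bar bar_bar yz by metis
    moreover have "bar z = x \<or> (x, bar z) \<in> E"
      using z E_bar bar_bar x by metis
    ultimately show False
      using y E_trans E_asym by metis
  qed
qed

lemma behind_Un:
  assumes x: "x \<in> D"
  shows "behind x \<union> behind (bar x) = h ` D"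
proof
  show "behind x \<union> behind (bar x) \<subseteq> h ` D"
    using bar_in by (auto simp: behind_def)
  show "h ` D \<subseteq> behind x \<union> behind (bar x)"
  proof
    fix v assume "v \<in> h ` D"
    then obtain w where w: "w \<in> D" "v = h w" by blast
    consider "w = x" | "w = bar x" | "(w, x) \<in> E" | "(x, w) \<in> E" | "(w, bar x) \<in> E" | "(bar x, w) \<in> E"
      using E_total[OF w(1) x] E_bar bar_bar w(1) x by metis
    then show "v \<in> behind x \<union> behind (bar x)"
    proof cases
      case 4
      then show ?thesis using behindI[of "bar w" "bar x"] w bar_in bar_bar E_bar by auto
    next
      case 6
      then have "(bar w, x) \<in> E" using E_bar bar_bar x by metis
      then show ?thesis using behindI[of "bar w" x] w bar_in bar_bar by auto
    qed (use w x head_behind head_behind_bar tail_behind in auto)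
  qed
qed

text \<open>Any dart related to \<open>x\<close> in one of the other ways has both ends on one side.
  So the edge of \<open>x\<close> is the whole cut, which gives both the components after its
  deletion and the absence of long cycles.\<close>

lemma arc_crossing:
  assumes x: "x \<in> D" and y: "y \<in> D" and tail: "h (bar y) \<in> behind x" and head: "h y \<in> behind (bar x)"
  shows "y = x"
proof (rule ccontr)
  assume "y \<noteq> x"
  have disj: "v \<notin> behind (bar x)" if "v \<in> behind x" for v
    using that behind_disjoint[OF x] by blast
  have "y \<noteq> bar x"
    using disj[of "h y"] head tail head_tail_neq tail_behind[OF x] head_behind_bar[OF x] bar_bar[OF x] disj
    by metis
  moreover have "(y, x) \<notin> E"
    using head_behind disj head by blast
  moreover have "(y, bar x) \<notin> E"
    using behindI[of y "bar x"] y disj tail by blast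
  moreover have "(x, y) \<notin> E"
    using head_behind[of "bar y" "bar x"] E_bar disj tail by blast
  moreover have "(bar x, y) \<notin> E"
    using behindI[of "bar y" x] E_bar[of "bar x" y] bar_bar x y bar_in disj head by auto
  ultimately show False
    using E_total[OF y x] \<open>y \<noteq> x\<close> E_bar bar_bar x y by metis
qed

section \<open>The constructed graph is a tree\<close>

lemma parcs_T_cases:
  assumes "(s, t) \<in> parcs T"
  obtains x where "x \<in> D" "s = h (bar x)" "t = h x"
  using assms by (auto simp: T_def)

lemma arc_in_T: "x \<in> D \<Longrightarrow> (h (bar x), h x) \<in> parcs T"
  by (auto simp: T_def)

lemma pair_graph_T: "pair_graph T"
proof
  show "symmetric (with_proj T)"
    using arc_in_T[OF bar_in] bar_bar by (auto simp: symmetric_def sym_def elim!: parcs_T_cases)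
qed (use bar_in finite_D head_tail_neq in \<open>auto simp: T_def\<close>)

sublocale T: pair_graph T
  by (rule pair_graph_T)

text \<open>Climbing from \<open>y\<close> to \<open>x\<close> through covering darts is a walk in
  \<open>T\<close>, as the head of each dart is the tail of the next; it never uses the edge of
  \<open>x\<close>.\<close>

lemma tails_behind_connected:
  assumes x: "x \<in> D"
  shows "y \<in> D \<Longrightarrow> y = x \<or> (y, x) \<in> E \<Longrightarrow>
    (h (bar y), h (bar x)) \<in> (parcs (delete_edge T {h (bar x), h x}))\<^sup>*"
proof (induction "size M - rank y" arbitrary: y rule: less_induct)
  case less
  show ?case
  proof (cases "y = x")
    case False
    then have yx: "(y, x) \<in> E" using less.prems by blast
    obtain c where c: "crit y c" "c = x \<or> (c, x) \<in> E"
      using crit_above[OF yx] .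
    have D: "c \<in> D" using c(1) critD E_D by blast
    have hy: "h y = h (bar c)"
      using h_eq[OF less.prems(1) bar_in[OF D]] c(1) bar_bar[OF D] by simp
    have "{h (bar y), h y} \<noteq> {h (bar x), h x}"
    proof
      assume "{h (bar y), h y} = {h (bar x), h x}"
      then have "y = x \<or> y = bar x"
        using arc_inj[of y x] arc_inj[of y "bar x"] less.prems(1) x bar_in bar_bar
        by (auto simp: doubleton_eq_iff)
      then show False using False yx E_neq bar_bar[OF x] by metis
    qed
    then have "(h (bar y), h (bar c)) \<in> parcs (delete_edge T {h (bar x), h x})"
      using arc_in_T[OF less.prems(1)] by (simp add: delete_edge_def hy)
    moreover have "(h (bar c), h (bar x)) \<in> (parcs (delete_edge T {h (bar x), h x}))\<^sup>*"
      using rank_less[OF critD[OF c(1)]] rank_bar[OF D] rank_pos[OF bar_in[OF D]] D c(2)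
      by (intro less.hyps) linarith+
    ultimately show ?thesis by (rule converse_rtrancl_into_rtrancl)
  qed simp
qed

lemma behind_connected:
  "x \<in> D \<Longrightarrow> v \<in> behind x \<Longrightarrow> (v, h (bar x)) \<in> (parcs (delete_edge T {h (bar x), h x}))\<^sup>*"
  using tails_behind_connected by (auto simp: behind_def)

lemma components_T:
  assumes x: "x \<in> D"
  shows "components (delete_edge T {h (bar x), h x}) = {behind x, behind (bar x)}"
proof (rule components_delete_edge[OF pair_graph_T])
  show "behind x \<union> behind (bar x) = pverts T" using behind_Un[OF x] by (simp add: T_def)
  show "(b, h x) \<in> (parcs (delete_edge T {h (bar x), h x}))\<^sup>*" if "b \<in> behind (bar x)" for b
    using behind_connected[OF bar_in[OF x] that] bar_bar[OF x] by (simp add: insert_commute)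
  show "(a, b) \<notin> parcs (delete_edge T {h (bar x), h x})" if "a \<in> behind x" "b \<in> behind (bar x)" for a b
  proof
    assume "(a, b) \<in> parcs (delete_edge T {h (bar x), h x})"
    then have "(a, b) \<in> parcs T" "{a, b} \<noteq> {h (bar x), h x}"
      by (auto simp: delete_edge_def)
    then show False
      using arc_crossing[OF x] that by (elim parcs_T_cases) auto
  qed
qed (use behind_disjoint[OF x] tail_behind[OF x] head_behind_bar[OF x] behind_connected[OF x] in auto)

lemma connected_T: "connected (with_proj T)"
proof -
  obtain x where x: "x \<in> D" using D_ne by blast
  have mono: "(parcs (delete_edge T e))\<^sup>* \<subseteq> (parcs T)\<^sup>*" for e
    by (rule rtrancl_mono) (auto simp: delete_edge_def)
  have "(v, h (bar x)) \<in> (parcs T)\<^sup>*" if v: "v \<in> pverts T" for v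
  proof -
    consider "v \<in> behind x" | "v \<in> behind (bar x)"
      using v behind_Un[OF x] by (auto simp: T_def)
    then show ?thesis
    proof cases
      case 1
      then show ?thesis using behind_connected[OF x] mono by blast
    next
      case 2
      then have "(v, h x) \<in> (parcs T)\<^sup>*"
        using behind_connected[OF bar_in[OF x] 2] mono bar_bar[OF x] by auto
      moreover have "(h x, h (bar x)) \<in> parcs T"
        using arc_in_T[OF x] T.arcs_symmetric by blast
      ultimately show ?thesis by simp
    qed
  qed
  then have to: "v \<rightarrow>\<^sup>*\<^bsub>with_proj T\<^esub> h (bar x)" if "v \<in> pverts T" for v
    using that reachable_iff_rtrancl[OF pair_graph_T] by blast
  then have "u \<rightarrow>\<^sup>*\<^bsub>with_proj T\<^esub> v" if "u \<in> pverts T" "v \<in> pverts T" for u v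
    using that T.symmetric_reachable' T.reachable_trans by meson
  then show ?thesis
    using D_ne by (simp add: connected_def strongly_connected_def T.mk_symmetric_with_proj) (simp add: T_def)
qed

text \<open>Every cycle has to return through each of its edges, since no other arc leads back across it.\<close>

lemma short_cycles:
  assumes "T.cycle p"
  shows "length p \<le> 2"
proof -
  obtain s where s: "T.awalk s p s" and dist: "distinct (tl (T.awalk_verts s p))" and "p \<noteq> []"
    using assms by (auto simp: T.cycle_def)
  then obtain a q where p: "p = a # q" by (cases p) auto
  obtain x where x: "x \<in> D" and a: "a = (h (bar x), h x)"
    using s p by (cases a) (auto simp: T.awalk_Cons_iff elim!: parcs_T_cases)
  have sx: "s = h (bar x)" and q: "T.awalk (h x) q s" and dq: "distinct (T.awalk_verts (h x) q)"
    using s dist p a by (auto simp: T.awalk_Cons_iff)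
  have crossing: "\<exists>e \<in> set r. e = (h x, h (bar x))" if "T.awalk t r s" "t \<in> behind (bar x)" for t r
    using that
  proof (induction r arbitrary: t)
    case Nil
    then show ?case
      using sx tail_behind[OF x] behind_disjoint[OF x] by (auto simp: T.awalk_Nil_iff)
  next
    case (Cons e r)
    then have e: "e \<in> parcs T" "t = fst e" and r: "T.awalk (snd e) r s"
      by (auto simp: T.awalk_Cons_iff)
    show ?case
    proof (cases "snd e \<in> behind (bar x)")
      case True
      then show ?thesis using Cons.IH[OF r] by auto
    next
      case False
      obtain y where y: "y \<in> D" "e = (h (bar y), h y)"
        using e(1) by (cases e) (auto elim!: parcs_T_cases)
      then have "h y \<in> behind x"
        using False behind_Un[OF x] by auto
      then have "y = bar x"
        using arc_crossing[OF bar_in[OF x] y(1)] y(2) e(2) Cons.prems(2) bar_bar[OF x] by simp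
      then show ?thesis using y bar_bar[OF x] by simp
    qed
  qed
  obtain b r where q_eq: "q = b # r"
    using crossing[OF q head_behind_bar[OF x]] by (cases q) auto
  have r: "T.awalk (snd b) r s" and b: "fst b = h x"
    using q q_eq by (auto simp: T.awalk_Cons_iff)
  \<comment> \<open>A cycle passes \<open>h x\<close> only once, so the arc back across the cut must
    be the very next one; what follows it is a path from \<open>s\<close> to \<open>s\<close>, hence
    empty.\<close>
  have "h x \<notin> set (T.awalk_verts (snd b) r)"
    using dq q_eq b by auto
  then have "(h x, h (bar x)) \<notin> set r"
    using T.awalk_verts_arc1[of "(h x, h (bar x))" r "snd b"] r by auto
  then have "b = (h x, h (bar x))"
    using crossing[OF q head_behind_bar[OF x]] q_eq by auto
  then have "T.apath s r s"
    using r dq q_eq sx by (auto simp: T.apath_def)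
  then have "r = []"
    using T.apath_nonempty_ends by blast
  then show ?thesis using p q_eq by simp
qed

lemma undirected_tree_T: "undirected_tree T"
  using pair_graph_T connected_T short_cycles by (fastforce simp: undirected_tree_def)

section \<open>Labels and degrees in the constructed tree\<close>

lemma darts_at_tail:
  assumes x: "x \<in> D"
  shows "{y \<in> D. h y = h (bar x)} = insert (bar x) {y. crit y x}"
proof -
  have "h y = h (bar x) \<longleftrightarrow> y = bar x \<or> crit y x" if "y \<in> D" for y
    using h_eq[OF that bar_in[OF x]] bar_bar[OF x] by simp
  moreover have "y \<in> D" if "crit y x" for y
    using that critD E_D by blast
  ultimately show ?thesis
    using bar_in[OF x] by blast
qed

lemma head_of_crit: "crit y x \<Longrightarrow> h y = h (bar x)"
  using darts_at_tail[of x] critD[of y x] E_D[of y x] by blast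

lemma bar_not_crit: "x \<in> D \<Longrightarrow> \<not> crit (bar x) x"
  using critD[of "bar x" x] E_neq bar_bar by metis

text \<open>Among the darts pointing to the tail of \<open>x\<close>, \<open>bar x\<close> reduces
  \<open>M\<close> to \<open>\<mu> x\<close>, and the others are the critical predecessors;
  consistency makes the remaining subtraction exact.\<close>

lemma lab_tail:
  assumes x: "x \<in> D"
  shows "lab (h (bar x)) + (\<Sum>y | crit y x. \<mu> y) = \<mu> x"
proof -
  have "(\<Sum>y | y \<in> D \<and> h y = h (bar x). \<mu> y) = \<mu> (bar x) + (\<Sum>y | crit y x. \<mu> y)"
    unfolding darts_at_tail[OF x] using finite_crit bar_not_crit[OF x] by simp
  moreover have "M = \<mu> x + \<mu> (bar x)"
    using part_bar[OF x] ..
  ultimately have "lab (h (bar x)) = \<mu> x - (\<Sum>y | crit y x. \<mu> y)"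
    unfolding lab_def by (metis add_diff_cancel_right' diff_diff_add)
  then show ?thesis
    using consistent_crit[OF x] by simp
qed

lemma finite_behind: "finite (behind x)"
  using finite_D by (simp add: behind_def)

lemma behind_mono: "(y, x) \<in> E \<Longrightarrow> behind y \<subseteq> behind x"
  unfolding behind_def using E_trans by blast

lemma behind_unfold:
  assumes x: "x \<in> D"
  shows "behind x = insert (h (bar x)) (\<Union>y\<in>{y. crit y x}. behind y)"
proof
  show "behind x \<subseteq> insert (h (bar x)) (\<Union>y\<in>{y. crit y x}. behind y)"
  proof
    fix v assume "v \<in> behind x"
    then obtain z where z: "z \<in> D" "v = h (bar z)" "z = x \<or> (z, x) \<in> E"
      by (auto simp: behind_def)
    show "v \<in> insert (h (bar x)) (\<Union>y\<in>{y. crit y x}. behind y)"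
    proof (cases "z = x")
      case False
      then obtain c where "crit c x" "z = c \<or> (z, c) \<in> E"
        using z crit_below by blast
      then show ?thesis using z behindI by blast
    qed (use z in simp)
  qed
  show "insert (h (bar x)) (\<Union>y\<in>{y. crit y x}. behind y) \<subseteq> behind x"
    using tail_behind[OF x] behind_mono critD by blast
qed

text \<open>\<open>behind_unfold\<close> splits the tail side into its end vertex and the disjoint
  tail sides of the critical predecessors; by induction the latter contribute their parts, exactly
  what \<open>lab_tail\<close> is short of \<open>\<mu> x\<close>.\<close>

lemma sum_lab_behind:
  "x \<in> D \<Longrightarrow> (\<Sum>v\<in>behind x. lab v) = \<mu> x"
proof (induction "rank x" arbitrary: x rule: less_induct)
  case less
  note x = less.prems
  have D: "y \<in> D" if "crit y x" for y
    using that critD E_D by blast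
  have tail: "h (bar x) \<notin> behind y" if "crit y x" for y
  proof -
    have "h (bar x) = h y"
      using head_of_crit that by metis
    then show ?thesis
      using head_behind_bar[OF D[OF that]] behind_disjoint[OF D[OF that]] by auto
  qed
  have disj: "behind y \<inter> behind y' = {}" if "crit y x" "crit y' x" "y \<noteq> y'" for y y'
  proof -
    have "h y = h y'"
      using head_of_crit that by metis
    then have "crit y (bar y')"
      using h_eq D that by blast
    then show ?thesis
      using behind_mono[OF critD] behind_disjoint[OF D[OF that(2)]] by blast
  qed
  have "(\<Sum>v\<in>behind x. lab v) = lab (h (bar x)) + (\<Sum>v\<in>(\<Union>y\<in>{y. crit y x}. behind y). lab v)"
    unfolding behind_unfold[OF x] using tail finite_behind finite_crit by (subst sum.insert) auto
  also have "(\<Sum>v\<in>(\<Union>y\<in>{y. crit y x}. behind y). lab v) = (\<Sum>y | crit y x. \<Sum>v\<in>behind y. lab v)"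
    using disj finite_behind finite_crit by (intro sum.UNION_disjoint) auto
  also have "\<dots> = (\<Sum>y | crit y x. \<mu> y)"
    using less.hyps D rank_less critD by (intro sum.cong) auto
  finally show ?case
    using lab_tail[OF x] by simp
qed

lemma M_tree_T: "M_tree M T lab"
  unfolding M_tree_def
proof (intro conjI ballI impI)
  obtain x where x: "x \<in> D" using D_ne by blast
  have "(\<Sum>v\<in>pverts T. lab v) = (\<Sum>v\<in>behind x. lab v) + (\<Sum>v\<in>behind (bar x). lab v)"
    using behind_Un[OF x] behind_disjoint[OF x] finite_behind
    by (subst sum.union_disjoint[symmetric]) (auto simp: T_def)
  then show "(\<Sum>v\<in>pverts T. lab v) = M"
    using sum_lab_behind x bar_in part_bar by simp
next
  fix v assume "v \<in> pverts T" and deg: "out_degree (with_proj T) v \<in> {1, 2}"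
  then obtain z where z: "z \<in> D" "v = h z" by (auto simp: T_def)
  \<comment> \<open>Reversing the dart turns \<open>v\<close> into a tail, where
    \<open>lab_tail\<close> applies.\<close>
  define x where "x = bar z"
  have x: "x \<in> D" and v: "v = h (bar x)" using z bar_in bar_bar by (auto simp: x_def)
  have "{w. (v, w) \<in> parcs T} = (\<lambda>y. h (bar y)) ` {y \<in> D. h y = v}"
  proof (intro equalityI subsetI)
    fix w assume "w \<in> {w. (v, w) \<in> parcs T}"
    then obtain y where "y \<in> D" "v = h (bar y)" "w = h y"
      by (auto elim: parcs_T_cases)
    then show "w \<in> (\<lambda>y. h (bar y)) ` {y \<in> D. h y = v}"
      using bar_in bar_bar by (intro image_eqI[of _ _ "bar y"]) auto
  qed (use arc_in_T T.arcs_symmetric in auto)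
  moreover have "inj_on (\<lambda>y. h (bar y)) {y \<in> D. h y = v}"
    using arc_inj by (auto simp: inj_on_def)
  ultimately have "out_degree (with_proj T) v = card {y \<in> D. h y = v}"
    by (simp add: T.out_degree_eq_card card_image)
  \<comment> \<open>The degree counts \<open>bar x\<close> besides the critical predecessors, so
    degree 1 or 2 leaves at most one of these. A single one has a part strictly inside
    \<open>\<mu> x\<close>; with none, \<open>\<mu> x\<close> is itself nonempty.\<close>
  then have card: "card {y. crit y x} \<in> {0, 1}"
    using deg finite_crit bar_not_crit[OF x] unfolding v darts_at_tail[OF x] by auto
  have "(\<Sum>y | crit y x. \<mu> y) \<noteq> \<mu> x"
  proof (cases "card {y. crit y x} = 0")
    case True
    then have "{y. crit y x} = {}" using finite_crit by simp
    then show ?thesis using part_ne[OF x] by (metis sum.empty)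
  next
    case False
    then have "card {y. crit y x} = 1" using card by auto
    then obtain y where y: "{y. crit y x} = {y}"
      by (auto simp: card_1_singleton_iff)
    then have "(y, x) \<in> E" using critD by blast
    then show ?thesis using E_part[of y x] unfolding y by auto
  qed
  then show "lab v \<noteq> {#}"
    using lab_tail[OF x] v by auto
qed (auto simp: lab_def undirected_tree_T)

lemma induced_split_T:
  assumes x: "x \<in> D"
  shows "induced_split T lab {h (bar x), h x} = {#\<mu> x, \<mu> (bar x)#}"
proof -
  have "behind x \<noteq> behind (bar x)"
    using behind_disjoint[OF x] tail_behind[OF x] by blast
  then show ?thesis
    by (simp add: induced_split_def components_T[OF x] sum_lab_behind x bar_in)
qed

lemma edges_T: "edges T = (\<lambda>x. {h (bar x), h x}) ` D"
  by (auto simp: edges_def T_def)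

lemma edge_eq_iff:
  assumes "x \<in> D" "y \<in> D"
  shows "{h (bar x), h x} = {h (bar y), h y} \<longleftrightarrow> x = y \<or> x = bar y"
  using arc_inj[of x y] arc_inj[of x "bar y"] assms bar_in bar_bar by (auto simp: doubleton_eq_iff)

end

lemma (in split_list) consistent_thin_imp_compatible:
  assumes thin: "thin Ss G" and cons: "consistent G" and "Ss \<noteq> []"
  shows "compatible_system M (mset Ss)"
proof -
  have verts: "pverts G = darts" and sub: "parcs G \<subseteq> parcs (split_containment_graph Ss)"
    and arcs: "\<And>x y. (x, y) \<in> parcs G \<Longrightarrow> (opp y, opp x) \<in> parcs G \<and> (x, opp y) \<notin> parcs G"
    and total: "\<And>x y. x \<in> darts \<Longrightarrow> y \<in> darts \<Longrightarrow> split_index x \<noteq> split_index y \<Longrightarrow>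
      (x, y) \<in> parcs G \<or> (y, x) \<in> parcs G \<or> (x, opp y) \<in> parcs G \<or> (opp y, x) \<in> parcs G"
    using thin unfolding thin_iff by blast+
  have arc: "x \<in> darts \<and> y \<in> darts \<and> split_index x \<noteq> split_index y \<and> part x \<subset># part y"
    if "(x, y) \<in> parcs G" for x y
    using that sub by (auto simp: split_containment_graph_def)
  have wf: "pair_wf_digraph G"
    using arc verts by unfold_locales auto
  have preds: "critical_preds G x =
      {y. (y, x) \<in> parcs G \<and> \<not> (\<exists>z. (y, z) \<in> (parcs G)\<^sup>+ \<and> (z, x) \<in> (parcs G)\<^sup>+)}" for x
    using critical_iff[OF wf acyclic_subset_split_containment_graph[OF sub]] arc verts
    unfolding critical_preds_def by blast
  interpret O: thin_order darts opp "parcs G" M part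
  proof
    show "(\<Sum>y\<in>{y. (y, x) \<in> parcs G \<and> \<not> (\<exists>z. (y, z) \<in> (parcs G)\<^sup>+ \<and> (z, x) \<in> (parcs G)\<^sup>+)}. part y) \<subseteq># part x"
      if "x \<in> darts" for x
      using cons that verts unfolding consistent_def preds by blast
    show "(x, y) \<in> parcs G \<or> (y, x) \<in> parcs G \<or> (x, opp y) \<in> parcs G \<or> (opp y, x) \<in> parcs G"
      if "x \<in> darts" "y \<in> darts" "y \<noteq> x" "y \<noteq> opp x" for x y
      using total[OF that(1,2)] same_index[OF that(1,2)] that(3,4) by metis
    show "y \<noteq> opp x" if "(x, y) \<in> parcs G" for x y
      using arc[OF that] index_opp by metis
    show "x \<in> darts \<and> y \<in> darts" "part x \<subset># part y" "(opp y, opp x) \<in> parcs G" "(x, opp y) \<notin> parcs G"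
      if "(x, y) \<in> parcs G" for x y
      using arc[OF that] arcs[OF that] by simp_all
  qed (simp_all add: finite_darts opp_in_darts opp_opp opp_neq part_opp part_nonempty)
  obtain h :: "'a scg_vertex \<Rightarrow> nat" where
    h: "\<forall>x \<in> darts. \<forall>y \<in> darts. h x = h y \<longleftrightarrow> x = y \<or> O.crit x (opp y)"
    using O.head_exists by blast
  \<comment> \<open>Vertices exist only as heads of darts, so at least one split is needed for the
    tree to have a vertex.\<close>
  have "darts \<noteq> {}"
    using ex_dart[of 0] \<open>Ss \<noteq> []\<close> by auto
  then interpret H: thin_order_head darts opp "parcs G" M part h
    using h by unfold_locales auto
  obtain rep where rep: "\<And>i. i < length Ss \<Longrightarrow> rep i \<in> darts \<and> split_index (rep i) = i"
    using ex_dart by metis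
  \<comment> \<open>One dart per index lists each edge exactly once, since only a dart and its
    opposite share an edge; repeated splits thus become distinct edges and multiplicities
    agree.\<close>
  define e where "e i = {h (opp (rep i)), h (rep i)}" for i
  have "e ` {..<length Ss} = edges H.T"
  proof
    show "e ` {..<length Ss} \<subseteq> edges H.T"
      using rep by (auto simp: e_def H.edges_T)
    show "edges H.T \<subseteq> e ` {..<length Ss}"
    proof
      fix d assume "d \<in> edges H.T"
      then obtain x where x: "x \<in> darts" "d = {h (opp x), h x}"
        by (auto simp: H.edges_T)
      let ?r = "rep (split_index x)"
      have r: "?r \<in> darts" "split_index ?r = split_index x"
        using rep index_less[OF x(1)] by auto
      then have "x = ?r \<or> x = opp ?r"
        using same_index x(1) by metis
      then have "d = e (split_index x)"
        unfolding e_def x(2) H.edge_eq_iff[OF x(1) r(1)] .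
      then show "d \<in> e ` {..<length Ss}"
        using index_less[OF x(1)] by blast
    qed
  qed
  moreover have "inj_on e {..<length Ss}"
  proof (rule inj_onI)
    fix i j assume "i \<in> {..<length Ss}" "j \<in> {..<length Ss}" "e i = e j"
    then have "rep i = rep j \<or> rep i = opp (rep j)"
      using H.edge_eq_iff rep unfolding e_def by blast
    then show "i = j"
      using rep index_opp \<open>i \<in> _\<close> \<open>j \<in> _\<close> by (metis lessThan_iff)
  qed
  ultimately have "mset_set (edges H.T) = image_mset e (mset_set {..<length Ss})"
    by (metis image_mset_mset_set)
  moreover have "induced_split H.T H.lab (e i) = Ss ! i" if "i < length Ss" for i
    using rep[OF that] H.induced_split_T[of "rep i"] split_eq[of "rep i"] by (simp add: e_def)
  ultimately have "represented_system H.T H.lab = image_mset ((!) Ss) (mset_set {..<length Ss})"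
    by (simp add: represented_system_def multiset.map_comp) (rule image_mset_cong, simp)
  also have "\<dots> = mset Ss"
    by (metis map_nth mset_map mset_upt lessThan_atLeast0)
  finally show ?thesis
    using H.M_tree_T unfolding compatible_system_def by blast
qed

theorem theorem3:
  fixes M :: "'a multiset" and Ss :: "'a split list"
  assumes "split_system M (mset Ss)" and "length Ss \<ge> 1"
  shows "compatible_system M (mset Ss) \<longleftrightarrow> (\<exists>G. thin Ss G \<and> consistent G)"
proof -
  interpret split_list M Ss
    by unfold_locales (rule assms(1))
  have "Ss \<noteq> []"
    using assms(2) by auto
  then show ?thesis
    using compatible_imp_consistent_thin consistent_thin_imp_compatible
    unfolding compatible_system_def by blast
qed

end
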